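(* Suppose that $0\le j\le t\le k\le n$ and that $\mathbb F$ is a field of characteristic $p=0$ or $p>n$. Then $\epsilon^k_t$ restricts to a map $E_{t,j}\to E_{k,j}$, and this restriction has rank $\min\{\binom nt\binom tj,\binom nk\binom kj\}$ over $\mathbb F$. In particular, $\epsilon^k_t:M^n_t\to M^n_k$ (whose matrix with respect to the bases $L^n_t$, $L^n_k$ is the $0$–$1$ incidence matrix $\mathcal S_{t,k}$ of $t$-faces versus $k$-faces under inclusion) has rank $$\sum_{0\le j\le t}\min\Big\{\binom nt\binom tj,\ \binom nk\binom kj\Big\}$$ over $\mathbb F$.
   Context: Let $V=\{\alpha_1,\bar\alpha_1,\dots,\alpha_n,\bar\alpha_n\}$ be a set of $2n$ distinct elements, with $\bar{\bar\alpha}_i=\alpha_i$. For $0\le k\le n$, $L^n_k$ is the set of $k$-element subsets $x\subseteq V$ with $|x\cap\{\alpha_i,\bar\alpha_i\}|\le1$ for all $i$ (the $k$-faces of the hyperoctahedron); $M^n_k$ is the $\mathbb F$-vector space with basis $L^n_k$. Elements are written as polynomials in the vertices: a product of distinct vertices forming such a set denotes that set, extended bilinearly. For $t\le k$, $\epsilon^k_t:M^n_t\to M^n_k$ is the linear map with $\epsilon^k_t(x)=\sum_{y\in L^n_k,\,y\supseteq x}y$ for $x\in L^n_t$. Let $\dot V=\{\alpha_1,\dots,\alpha_n\}$; for disjoint $a,b\subseteq\dot V$, $[a,b]=\prod_{\alpha\in a}(\alpha+\bar\alpha)\prod_{\beta\in b}(\beta-\bar\beta)$, $[\emptyset,\emptyset]=\emptyset$.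 For $0\le j\le s\le n$, $E_{s,j}$ is the subspace of $M^n_s$ spanned by all $[a,b]$ with $a,b\subseteq\dot V$ disjoint, $|a|=s-j$, $|b|=j$. *)

theory Defs
  imports "HOL-Computational_Algebra.Computational_Algebra" "HOL-Library.Poly_Mapping"
begin

section \<open>Faces of the hyperoctahedron\<close>

text \<open>The vertex \<open>\<alpha>\<^sub>i\<close> is \<open>(i, True)\<close> and its antipode is \<open>(i, False)\<close>.\<close>

type_synonym vertex = "nat \<times> bool"

definition bar :: "vertex \<Rightarrow> vertex" where
  "bar v = (fst v, \<not> snd v)"

definition Vdot :: "nat \<Rightarrow> vertex set" where
  "Vdot n = {1..n} \<times> {True}"

definition Vn :: "nat \<Rightarrow> vertex set" where
  "Vn n = Vdot n \<union> bar ` Vdot n"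

definition Ln :: "nat \<Rightarrow> nat \<Rightarrow> vertex set set" where
  "Ln n k = {x. x \<subseteq> Vn n \<and> card x = k \<and> (\<forall>v\<in>Vdot n. card (x \<inter> {v, bar v}) \<le> 1)}"


section \<open>Polynomials in the vertices\<close>

text \<open>
  A monomial in the vertices is a multiset of vertices, so the polynomial ring is the
  monoid algebra of finite multisets; a face is identified with the corresponding square-free
  monomial.
\<close>

type_synonym 'f vpoly = "vertex multiset \<Rightarrow>\<^sub>0 'f"

definition vscale :: "'f::field \<Rightarrow> 'f vpoly \<Rightarrow> 'f vpoly" where
  "vscale c = Poly_Mapping.map ((*) c)"

lemma lookup_vscale [simp]: "Poly_Mapping.lookup (vscale c p) m = c * Poly_Mapping.lookup p m"
  by (simp add: vscale_def Poly_Mapping.map.rep_eq when_def)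

interpretation vp: vector_space "vscale :: 'f::field \<Rightarrow> 'f vpoly \<Rightarrow> 'f vpoly"
  by unfold_locales
     (auto intro!: poly_mapping_eqI simp: lookup_add algebra_simps)

definition var :: "vertex \<Rightarrow> 'f::field vpoly" where
  "var v = Poly_Mapping.single {#v#} 1"

definition face :: "vertex set \<Rightarrow> 'f::field vpoly" where
  "face x = Poly_Mapping.single (mset_set x) 1"

lemma face_eq_prod: "finite x \<Longrightarrow> (face x :: 'f::field vpoly) = (\<Prod>v\<in>x. var v)"
proof (induction x rule: finite_induct)
  case (insert v x)
  from insert.hyps(1,2) have "face (insert v x) = var v * (face x :: 'f vpoly)"
    by (simp add: face_def var_def mult_single del: prod.insert)
  then show ?case using insert by simp
qed (simp add: face_def)

definition face_basis :: "nat \<Rightarrow> nat \<Rightarrow> 'f::field vpoly set" where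
  "face_basis n k = face ` Ln n k"

definition Mn :: "nat \<Rightarrow> nat \<Rightarrow> 'f::field vpoly set" where
  "Mn n k = vp.span (face_basis n k)"

lemma finite_Vn: "finite (Vn n)"
  by (simp add: Vn_def Vdot_def)

lemma finite_face: "x \<in> Ln n k \<Longrightarrow> finite x"
  using finite_Vn finite_subset by (auto simp: Ln_def)

lemma finite_Ln: "finite (Ln n k)"
  by (rule finite_subset[of _ "Pow (Vn n)"]) (auto simp: Ln_def finite_Vn)

lemma lookup_face:
  assumes "finite x" "finite y"
  shows "Poly_Mapping.lookup (face x) (mset_set y) = (if x = y then 1 else 0)"
  using assms by (auto simp: face_def lookup_single when_def)

lemma inj_on_face: "inj_on (face :: _ \<Rightarrow> 'f::field vpoly) (Ln n k)"
proof (rule inj_onI)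
  fix x y assume xy: "x \<in> Ln n k" "y \<in> Ln n k" "face x = (face y :: 'f vpoly)"
  have "Poly_Mapping.lookup (face x :: 'f vpoly) (mset_set y) = 1"
    using xy by (simp add: lookup_face finite_face)
  then show "x = y"
    using xy lookup_face[of x y, where 'a='f] finite_face[of x] finite_face[of y]
    by (auto split: if_splits)
qed

lemma independent_face_basis: "\<not> vp.dependent (face_basis n k :: 'f::field vpoly set)"
proof
  assume "vp.dependent (face_basis n k :: 'f vpoly set)"
  moreover have "finite (face_basis n k :: 'f vpoly set)"
    by (simp add: face_basis_def finite_Ln)
  ultimately obtain u v where v: "v \<in> (face_basis n k :: 'f vpoly set)" "u v \<noteq> 0"
    and s: "(\<Sum>w\<in>face_basis n k. vscale (u w) w) = 0"
    using vp.dependent_finite by blast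
  obtain y where y: "y \<in> Ln n k" "v = face y" using v by (auto simp: face_basis_def)
  have "0 = Poly_Mapping.lookup (\<Sum>x\<in>Ln n k. vscale (u (face x)) (face x)) (mset_set y)"
    using s by (simp add: face_basis_def sum.reindex[OF inj_on_face])
  also have "\<dots> = (\<Sum>x\<in>Ln n k. if x = y then u (face x) else 0)"
    unfolding lookup_sum using y finite_face by (intro sum.cong) (auto simp: lookup_face)
  also have "\<dots> = u v" using y finite_Ln by simp
  finally show False using v by simp
qed


section \<open>The inclusion maps and the subspaces $E_{s,j}$\<close>

text \<open>
  The map is given on all polynomials; only its values on \<open>Mn n t\<close> matter, where it is the linear
  extension of the assignment in \<open>eps_face\<close> below.
\<close>

definition eps :: "nat \<Rightarrow> nat \<Rightarrow> nat \<Rightarrow> 'f::field vpoly \<Rightarrow> 'f vpoly" where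
  "eps n t k p =
     (\<Sum>x\<in>Ln n t. vscale (Poly_Mapping.lookup p (mset_set x)) (\<Sum>y | y \<in> Ln n k \<and> x \<subseteq> y. face y))"

lemma linear_eps: "Vector_Spaces.linear vscale vscale (eps n t k)"
  by unfold_locales
     (auto simp: eps_def lookup_add vp.scale_left_distrib sum.distrib vp.scale_sum_right)

lemma eps_face:
  assumes "x \<in> Ln n t"
  shows "eps n t k (face x) = (\<Sum>y | y \<in> Ln n k \<and> x \<subseteq> y. face y)"
proof -
  have "eps n t k (face x :: 'a vpoly) =
      (\<Sum>z\<in>Ln n t. if z = x then (\<Sum>y | y \<in> Ln n k \<and> x \<subseteq> y. face y) else 0)"
    unfolding eps_def using assms
    by (intro sum.cong) (auto simp: lookup_face finite_face)
  then show ?thesis using assms finite_Ln by simp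
qed

definition incidence :: "vertex set \<Rightarrow> vertex set \<Rightarrow> 'f::field" where
  "incidence x y = (if x \<subseteq> y then 1 else 0)"

definition bracket :: "vertex set \<Rightarrow> vertex set \<Rightarrow> 'f::field vpoly" where
  "bracket a b = (\<Prod>\<alpha>\<in>a. var \<alpha> + var (bar \<alpha>)) * (\<Prod>\<beta>\<in>b. var \<beta> - var (bar \<beta>))"

definition En :: "nat \<Rightarrow> nat \<Rightarrow> nat \<Rightarrow> 'f::field vpoly set" where
  "En n s j = vp.span {bracket a b | a b.
     a \<subseteq> Vdot n \<and> b \<subseteq> Vdot n \<and> a \<inter> b = {} \<and> card a = s - j \<and> card b = j}"

end

theory Submission
  imports Defs "HOL-Library.Disjoint_Sets"
begin

text \<open>
  Multiplying out shows that \<open>eps\<close> sends \<open>[a, b]\<close> to the sum of all \<open>[a', b]\<close> with \<open>a \<subseteq> a'\<close>,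
  \<open>a'\<close> disjoint from \<open>b\<close>, and \<open>|a'| = k - j\<close>. So on \<open>E\<^bsub>t,j\<^esub>\<close>, for each fixed \<open>b\<close>, the map is
  the inclusion matrix of \<open>(t - j)\<close>-subsets versus \<open>(k - j)\<close>-subsets of an \<open>(n - j)\<close>-set, which has
  full rank in the given characteristics: it is injective if \<open>t + k \<le> n + j\<close> and surjective if
  \<open>t + k \<ge> n + j\<close>. The rank on \<open>M\<^bsub>t\<^esub>\<close> follows because, \<open>2\<close> being invertible, the brackets span
  \<open>M\<^bsub>s\<^esub>\<close>; there are as many of them as faces, so they form a basis and \<open>M\<^bsub>s\<^esub>\<close> is the direct sum
  of the \<open>E\<^bsub>s,j\<^esub>\<close>.
\<close>

section \<open>Linear algebra\<close>

context vector_space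
begin

text \<open>Independence of a family means injectivity plus independence of its range. Injectivity
  comes from the same hypothesis: equal values at \<open>i\<close> and \<open>j\<close> would give a
  relation with coefficients 1 and -1.\<close>

lemma independent_familyI:
  assumes "finite I"
    and "\<And>f i. (\<Sum>i\<in>I. f i *s g i) = 0 \<Longrightarrow> i \<in> I \<Longrightarrow> f i = 0"
  shows "inj_on g I" "independent (g ` I)"
proof -
  show inj: "inj_on g I"
  proof (rule inj_onI, rule ccontr)
    fix i j assume ij: "i \<in> I" "j \<in> I" "g i = g j" "i \<noteq> j"
    let ?f = "(\<lambda>_. 0 :: 'a)(i := 1, j := -1)"
    have "(\<Sum>l\<in>I. ?f l *s g l) = (\<Sum>l\<in>{i, j}. ?f l *s g l)"
      using assms(1) ij by (intro sum.mono_neutral_right) auto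
    also have "\<dots> = 0" using ij by simp
    finally have "?f j = 0" using ij by (intro assms(2)[of ?f j])
    then show False by simp
  qed
  show "independent (g ` I)"
    using assms by (intro independent_if_scalars_zero) (auto simp: sum.reindex[OF inj])
qed

lemma independent_familyD:
  assumes "finite I" "inj_on g I" "independent (g ` I)"
    and "(\<Sum>i\<in>I. f i *s g i) = 0" "i \<in> I"
  shows "f i = 0"
proof -
  have "(\<Sum>v\<in>g ` I. f (the_inv_into I g v) *s v) = (\<Sum>i\<in>I. f i *s g i)"
    by (simp add: sum.reindex[OF assms(2)] the_inv_into_f_f[OF assms(2)])
  then have "f (the_inv_into I g (g i)) = 0"
    using assms by (intro independentD[of "g ` I" "g ` I"]) auto
  then show ?thesis using assms by (simp add: the_inv_into_f_f)
qed

lemma card_le_of_independent_in_span: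
  assumes "finite T" "independent S" "S \<subseteq> span T"
  shows "card S \<le> card T"
  using independent_span_bound[OF assms] by simp

text \<open>By Steinitz exchange, a repeated or redundant vector among the \<open>g i\<close> would
  leave a spanning set smaller than the independent set \<open>L\<close>. This turns a spanning
  family of the right size into a basis.\<close>

lemma independent_family_if_spanning:
  assumes "finite I" "independent L" "card L = card I" "L \<subseteq> span (g ` I)"
  shows "inj_on g I" "independent (g ` I)"
proof -
  have "card L \<le> card (g ` I)"
    using assms by (intro card_le_of_independent_in_span) auto
  then have card: "card (g ` I) = card I"
    using assms card_image_le[OF assms(1), of g] by simp
  then show "inj_on g I" by (rule eq_card_imp_inj_on[OF assms(1)])
  show "independent (g ` I)"
  proof
    assume "dependent (g ` I)"
    then obtain v where v: "v \<in> g ` I" "v \<in> span (g ` I - {v})"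
      unfolding dependent_def by blast
    have "span (g ` I - {v}) = span (g ` I)"
      using span_redundant[OF v(2)] v(1) by (simp add: insert_absorb)
    then have "card L \<le> card (g ` I - {v})"
      using assms by (intro card_le_of_independent_in_span) auto
    also have "\<dots> < card (g ` I)" using v assms(1) by (intro card_Diff1_less) auto
    finally show False using card assms by simp
  qed
qed

text \<open>The spans of the disjoint blocks \<open>B j\<close> form a direct sum: each
  \<open>x j\<close> has coordinates only on its own block, so at any basis vector a single summand
  contributes to the vanishing total coordinate.\<close>

lemma components_eq_0:
  assumes "finite J" "independent (\<Union>j\<in>J. B j)" "disjoint_family_on B J"
    and "\<And>j. j \<in> J \<Longrightarrow> x j \<in> span (B j)" "(\<Sum>j\<in>J. x j) = 0" "i \<in> J"
  shows "x i = 0"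
proof -
  let ?B = "\<Union>j\<in>J. B j"
  have sub: "B j \<subseteq> ?B" if "j \<in> J" for j using that by auto
  have x: "x j \<in> span ?B" if "j \<in> J" for j
    using assms(4)[OF that] span_mono[OF sub[OF that]] by blast
  have supp: "b \<in> B j" if "representation ?B (x j) b \<noteq> 0" "j \<in> J" for j b
    using that(1) representation_extend[OF assms(2) assms(4)[OF that(2)] sub[OF that(2)]]
      representation_ne_zero[of "B j" "x j" b] by auto
  have rep0: "(\<Sum>j\<in>J. representation ?B (x j) b) = 0" for b
    using representation_sum[OF assms(2), of J x] x assms(5)
      representation_zero by (metis (no_types, lifting))
  have "representation ?B (x i) b = 0" for b
  proof (rule ccontr)
    assume nz: "representation ?B (x i) b \<noteq> 0"
    have "(\<Sum>j\<in>J. representation ?B (x j) b) = (\<Sum>j\<in>{i}. representation ?B (x j) b)"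
      using assms(1,3,6) supp[OF nz assms(6)] supp
      by (intro sum.mono_neutral_right) (auto simp: disjoint_family_on_def, blast)
    then show False using nz rep0 by simp
  qed
  then show ?thesis
    using sum_nonzero_representation_eq[OF assms(2) x[OF assms(6)]] by simp
qed

text \<open>A relation splits into its components in the direct summands, each of which must vanish.
  Indexing by \<open>Sigma J C\<close> instead of the union also shows that the \<open>C j\<close>
  do not overlap, whence the cardinality.\<close>

lemma independent_Union_of_components:
  assumes "finite J" "independent (\<Union>j\<in>J. B j)" "disjoint_family_on B J"
    and C: "\<And>j. j \<in> J \<Longrightarrow> finite (C j)" "\<And>j. j \<in> J \<Longrightarrow> independent (C j)"
      "\<And>j. j \<in> J \<Longrightarrow> C j \<subseteq> span (B j)"
  shows "independent (\<Union>j\<in>J. C j)" "card (\<Union>j\<in>J. C j) = (\<Sum>j\<in>J. card (C j))"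
proof -
  have fin: "finite (Sigma J C)" using assms by auto
  have eq0: "f p = 0" if "(\<Sum>p\<in>Sigma J C. f p *s snd p) = 0" "p \<in> Sigma J C" for f p
  proof -
    obtain i c where p: "p = (i, c)" "i \<in> J" "c \<in> C i" using \<open>p \<in> Sigma J C\<close> by auto
    have "(\<Sum>j\<in>J. \<Sum>c\<in>C j. f (j, c) *s c) = (\<Sum>p\<in>Sigma J C. f p *s snd p)"
      using assms(1) C by (subst sum.Sigma) (auto intro!: sum.cong)
    then have "(\<Sum>c\<in>C i. f (i, c) *s c) = 0"
      using that(1) assms(1-3) p(2) C(3)
      by (intro components_eq_0[where B = B and x = "\<lambda>j. \<Sum>c\<in>C j. f (j, c) *s c"])
         (auto intro!: span_sum span_scale)
    then show ?thesis using C p independentD[of "C i" "C i" "\<lambda>c. f (i, c)"] by auto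
  qed
  have *: "inj_on snd (Sigma J C)" "independent (snd ` Sigma J C)"
    by (rule independent_familyI[OF fin], erule (1) eq0)+
  have img: "snd ` Sigma J C = (\<Union>j\<in>J. C j)" by force
  show "independent (\<Union>j\<in>J. C j)" using *(2) img by simp
  have "card (\<Union>j\<in>J. C j) = card (Sigma J C)" using card_image[OF *(1)] img by simp
  then show "card (\<Union>j\<in>J. C j) = (\<Sum>j\<in>J. card (C j))"
    using assms(1) C by simp
qed

end

section \<open>Inclusion matrices of subsets of a finite set\<close>

text \<open>A positive characteristic is here a prime above \<open>m\<close>, so it does not divide
  \<open>fact a\<close> and hence not its divisor \<open>a choose b\<close>.\<close>

lemma of_nat_choose_neq_0:
  assumes "CHAR('f::field) = 0 \<or> CHAR('f) > m" "a \<le> m" "b \<le> a"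
  shows "of_nat (a choose b) \<noteq> (0::'f)"
proof
  assume "of_nat (a choose b) = (0::'f)"
  then have dvd: "CHAR('f) dvd (a choose b)" by (simp add: of_nat_eq_0_iff_char_dvd)
  with assms have pos: "CHAR('f) > m" by auto
  then have "prime (CHAR('f))" by (intro prime_CHAR_semidom) simp
  moreover have "CHAR('f) dvd fact a"
    using dvd binomial_fact_lemma[OF assms(3)] by (metis dvd_mult)
  ultimately show False using prime_dvd_fact_iff[of "CHAR('f)" a] pos assms by simp
qed

lemma card_between:
  assumes "finite V" "U \<subseteq> V" "card U \<le> q"
  shows "card {z. U \<subseteq> z \<and> z \<subseteq> V \<and> card z = q} = (card V - card U) choose (q - card U)"
proof -
  have fU: "finite U" using assms finite_subset by auto
  have fz: "finite z" if "z \<subseteq> V" for z using that assms finite_subset by auto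
  have "bij_betw (\<lambda>z. z - U) {z. U \<subseteq> z \<and> z \<subseteq> V \<and> card z = q}
     {w. w \<subseteq> V - U \<and> card w = q - card U}"
  proof (rule bij_betwI[where g = "\<lambda>w. w \<union> U"])
    show "(\<lambda>w. w \<union> U) \<in> {w. w \<subseteq> V - U \<and> card w = q - card U} \<rightarrow>
       {z. U \<subseteq> z \<and> z \<subseteq> V \<and> card z = q}"
    proof
      fix w assume "w \<in> {w. w \<subseteq> V - U \<and> card w = q - card U}"
      then have w: "w \<subseteq> V - U" "card w = q - card U" by auto
      have "card (w \<union> U) = card w + card U"
        using w fU fz[of w] by (intro card_Un_disjoint) auto
      then show "w \<union> U \<in> {z. U \<subseteq> z \<and> z \<subseteq> V \<and> card z = q}"
        using w assms by auto
    qed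
  qed (use fU in \<open>auto simp: card_Diff_subset\<close>)
  then have "card {z. U \<subseteq> z \<and> z \<subseteq> V \<and> card z = q} = card {w. w \<subseteq> V - U \<and> card w = q - card U}"
    by (rule bij_betw_same_card)
  also have "\<dots> = card (V - U) choose (q - card U)"
    using assms by (intro n_subsets) auto
  finally show ?thesis using assms fU by (simp add: card_Diff_subset)
qed

text \<open>Summing \<open>h\<close> over the \<open>s\<close>-sets with a prescribed trace \<open>B\<close> on \<open>A\<close> gives a combination of
  the trace sums of \<open>f\<close> for the subsets of \<open>B\<close>, with nonzero coefficient at \<open>B\<close> itself; hence all
  trace sums vanish, and the one for \<open>B = A\<close> is \<open>f A\<close>.\<close>

lemma inclusion_matrix_injective:
  fixes f :: "'a set \<Rightarrow> 'f::field"
  assumes X: "finite X" "card X \<le> m" and char: "CHAR('f) = 0 \<or> CHAR('f) > m"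
    and rs: "r \<le> s" "r + s \<le> card X"
    and zero: "\<And>y. y \<subseteq> X \<Longrightarrow> card y = s \<Longrightarrow> (\<Sum>x | x \<subseteq> y \<and> card x = r. f x) = 0"
    and A: "A \<subseteq> X" "card A = r"
  shows "f A = 0"
proof -
  have fA: "finite A" using A X finite_subset by auto
  have fz: "finite z" if "z \<subseteq> X" for z using that X finite_subset by auto
  have fin: "finite W" if "W \<subseteq> Pow X" for W
    using X that finite_subset by blast
  define F where "F B = (\<Sum>x | x \<subseteq> X \<and> card x = r \<and> x \<inter> A = B. f x)" for B
  have "F B = 0" if "B \<subseteq> A" for B
    using that
  proof (induction "card B" arbitrary: B rule: less_induct)
    case less
    let ?Y = "{y. y \<subseteq> X \<and> card y = s \<and> y \<inter> A = B}"
    \<comment> \<open>The number of \<open>s\<close>-sets \<open>y\<close> with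
      \<open>y \<inter> A = B\<close> containing a given \<open>r\<close>-set of trace
      \<open>C\<close> on \<open>A\<close>. Without the guard, truncated subtraction would count an
      impossible choice as \<open>choose 0\<close>, that is, as 1.\<close>
    let ?N = "\<lambda>C. if r - card C \<le> s - card B
      then (card X - r - (r - card C)) choose (s - card B - (r - card C)) else 0"
    have fB: "finite B" and BX: "B \<subseteq> X" and cB: "card B \<le> r"
      using less.prems fA A finite_subset card_mono by auto
    have count: "card {y. y \<subseteq> X \<and> card y = s \<and> y \<inter> A = B \<and> x \<subseteq> y} = ?N (x \<inter> A)"
      if x: "x \<subseteq> X" "card x = r" "x \<inter> A \<subseteq> B" for x
    proof -
      have fx: "finite x" using x fz by auto
      have c: "card (x - A) = r - card (x \<inter> A)"
        using x fx by (simp add: card_Diff_subset_Int)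
      have cAB: "card (x \<inter> A) \<le> card B" "card (x \<inter> A) \<le> r" "card B \<le> r"
        using x fB cB card_mono[OF fx, of "x \<inter> A"] by (auto intro!: card_mono)
      have "bij_betw (\<lambda>y. y - A) {y. y \<subseteq> X \<and> card y = s \<and> y \<inter> A = B \<and> x \<subseteq> y}
         {z. x - A \<subseteq> z \<and> z \<subseteq> X - A \<and> card z = s - card B}"
      proof (rule bij_betwI[where g = "\<lambda>z. z \<union> B"])
        show "(\<lambda>y. y - A) \<in> {y. y \<subseteq> X \<and> card y = s \<and> y \<inter> A = B \<and> x \<subseteq> y} \<rightarrow>
          {z. x - A \<subseteq> z \<and> z \<subseteq> X - A \<and> card z = s - card B}"
          using fz by (auto simp: card_Diff_subset_Int)
        show "(\<lambda>z. z \<union> B) \<in> {z. x - A \<subseteq> z \<and> z \<subseteq> X - A \<and> card z = s - card B} \<rightarrow>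
          {y. y \<subseteq> X \<and> card y = s \<and> y \<inter> A = B \<and> x \<subseteq> y}"
        proof
          fix z assume "z \<in> {z. x - A \<subseteq> z \<and> z \<subseteq> X - A \<and> card z = s - card B}"
          then have z: "x - A \<subseteq> z" "z \<subseteq> X - A" "card z = s - card B" by auto
          have "card (z \<union> B) = card z + card B"
            using z fB less.prems fz[of z] by (intro card_Un_disjoint) auto
          then show "z \<union> B \<in> {y. y \<subseteq> X \<and> card y = s \<and> y \<inter> A = B \<and> x \<subseteq> y}"
            using z x less.prems BX cB rs by auto
        qed
      qed (use less.prems in auto)
      then have "card {y. y \<subseteq> X \<and> card y = s \<and> y \<inter> A = B \<and> x \<subseteq> y} =
        card {z. x - A \<subseteq> z \<and> z \<subseteq> X - A \<and> card z = s - card B}"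
        by (rule bij_betw_same_card)
      also have "\<dots> = ?N (x \<inter> A)"
      proof (cases "r - card (x \<inter> A) \<le> s - card B")
        case True
        then have "card {z. x - A \<subseteq> z \<and> z \<subseteq> X - A \<and> card z = s - card B} =
          (card (X - A) - card (x - A)) choose (s - card B - card (x - A))"
          using X x c by (intro card_between) auto
        then show ?thesis using True A fA c by (simp add: card_Diff_subset)
      next
        case False
        have "card z \<noteq> s - card B" if "x - A \<subseteq> z" "z \<subseteq> X - A" for z
        proof -
          have "card (x - A) \<le> card z" using that fz[of z] by (intro card_mono) auto
          then show ?thesis using False c by linarith
        qed
        then have "{z. x - A \<subseteq> z \<and> z \<subseteq> X - A \<and> card z = s - card B} = {}" by blast
        then show ?thesis using False by (simp only: card.empty if_False)
      qed
      finally show ?thesis .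
    qed
    have "0 = (\<Sum>y\<in>?Y. \<Sum>x | x \<subseteq> y \<and> card x = r. f x)"
      using zero by simp
    also have "\<dots> = (\<Sum>(y, x)\<in>Sigma ?Y (\<lambda>y. {x. x \<subseteq> y \<and> card x = r}). f x)"
      using X fz by (intro sum.Sigma) (auto intro!: fin)
    \<comment> \<open>The order of summation is exchanged; \<open>x \<subseteq> y\<close> and
      \<open>y \<inter> A = B\<close> force \<open>x \<inter> A \<subseteq> B\<close>.\<close>
    also have "\<dots> = (\<Sum>(x, y)\<in>Sigma {x. x \<subseteq> X \<and> card x = r \<and> x \<inter> A \<subseteq> B}
        (\<lambda>x. {y. y \<subseteq> X \<and> card y = s \<and> y \<inter> A = B \<and> x \<subseteq> y}). f x)"
      by (rule sum.reindex_bij_witness[of _ prod.swap prod.swap]) (auto, blast+)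
    also have "\<dots> = (\<Sum>x | x \<subseteq> X \<and> card x = r \<and> x \<inter> A \<subseteq> B. of_nat (?N (x \<inter> A)) * f x)"
      using count by (subst sum.Sigma[symmetric]) (auto intro!: sum.cong fin)
    also have "\<dots> = (\<Sum>C\<in>Pow B. \<Sum>x | x \<in> {x. x \<subseteq> X \<and> card x = r \<and> x \<inter> A \<subseteq> B} \<and> x \<inter> A = C.
        of_nat (?N (x \<inter> A)) * f x)"
      using fB by (intro sum.group[symmetric]) (auto intro!: fin)
    also have "\<dots> = (\<Sum>C\<in>Pow B. of_nat (?N C) * F C)"
      unfolding F_def sum_distrib_left by (intro sum.cong) auto
    also have "\<dots> = (\<Sum>C\<in>{B}. of_nat (?N C) * F C)"
    proof (rule sum.mono_neutral_right)
      \<comment> \<open>Proper subsets of \<open>B\<close> have smaller cardinality, so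
        \<open>F C = 0\<close> by induction.\<close>
      show "\<forall>C\<in>Pow B - {B}. of_nat (?N C) * F C = 0"
        using less fB by (auto intro!: psubset_card_mono)
    qed (use fB in auto)
    finally have "of_nat (?N B) * F B = 0" by simp
    moreover have "of_nat (?N B) \<noteq> (0::'f)"
    proof -
      \<comment> \<open>The lower index equals \<open>s - r\<close>, and
        \<open>r + s \<le> card X\<close> keeps it below or equal to the upper one.\<close>
      have "of_nat ((card X - r - (r - card B)) choose (s - card B - (r - card B))) \<noteq> (0::'f)"
        by (rule of_nat_choose_neq_0[OF char]) (use X(2) rs cB in linarith)+
      then show ?thesis using rs(1) by simp
    qed
    ultimately show ?case by simp
  qed
  moreover have "F A = f A"
  proof -
    have "A = x" if "x \<subseteq> X" "card x = r" "x \<inter> A = A" for x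
      by (rule card_subset_eq) (use that A fz in auto)
    then have "{x. x \<subseteq> X \<and> card x = r \<and> x \<inter> A = A} = {A}"
      using A by blast
    then show ?thesis by (simp add: F_def)
  qed
  ultimately show ?thesis by auto
qed

text \<open>Dually, summing the rows over the \<open>r\<close>-sets whose union with \<open>A\<close> is \<open>D\<close> gives a combination of
  the sums of \<open>e y\<close> over the \<open>s\<close>-sets with \<open>y \<union> A = E\<close>, for \<open>E \<supseteq> D\<close>.\<close>

lemma (in vector_space) inclusion_matrix_surjective:
  fixes e :: "'c set \<Rightarrow> 'b"
  assumes X: "finite X" "card X \<le> m" and char: "CHAR('a) = 0 \<or> CHAR('a) > m"
    and rs: "r \<le> s" "card X \<le> r + s"
    and S: "subspace S"
      "\<And>x. x \<subseteq> X \<Longrightarrow> card x = r \<Longrightarrow> (\<Sum>y | x \<subseteq> y \<and> y \<subseteq> X \<and> card y = s. e y) \<in> S"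
    and A: "A \<subseteq> X" "card A = s"
  shows "e A \<in> S"
proof -
  have fA: "finite A" using A X finite_subset by auto
  have fz: "finite z" if "z \<subseteq> X" for z using that X finite_subset by auto
  have fin: "finite W" if "W \<subseteq> Pow X" for W
    using X that finite_subset by blast
  define u where "u D = (\<Sum>y | y \<subseteq> X \<and> card y = s \<and> y \<union> A = D. e y)" for D
  have "u D \<in> S" if "A \<subseteq> D" "D \<subseteq> X" for D
    using that
  proof (induction "card (X - D)" arbitrary: D rule: less_induct)
    case less
    let ?R = "{x. x \<subseteq> X \<and> card x = r \<and> x \<union> A = D}"
    \<comment> \<open>The number of \<open>r\<close>-sets \<open>x \<subseteq> y\<close> with
      \<open>x \<union> A = D\<close>, when \<open>y \<union> A = E\<close>: such an
      \<open>x\<close> is \<open>D - A\<close> together with part of \<open>y \<inter> A\<close>,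
      which has \<open>s - card (E - A)\<close> elements.\<close>
    let ?N = "\<lambda>E. (s - card (E - A)) choose (r - card (D - A))"
    \<comment> \<open>Here \<open>card X \<le> r + s\<close> enters: an \<open>r\<close>-set has
      room for \<open>D - A\<close>, so the lower index in \<open>?N\<close> is not
      truncated.\<close>
    have cD: "card (D - A) \<le> r"
    proof -
      have "card (D - A) \<le> card (X - A)" using less.prems X by (intro card_mono) auto
      also have "\<dots> = card X - s" using A fA by (simp add: card_Diff_subset)
      finally show ?thesis using rs by simp
    qed
    have count: "card {x. x \<subseteq> X \<and> card x = r \<and> x \<union> A = D \<and> x \<subseteq> y} = ?N (y \<union> A)"
      if y: "y \<subseteq> X" "card y = s" "D \<subseteq> y \<union> A" for y
    proof -
      have fy: "finite y" using y fz by auto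
      have fDA: "finite (D - A)" using less.prems fz by auto
      have "{x. x \<subseteq> X \<and> card x = r \<and> x \<union> A = D \<and> x \<subseteq> y} =
        {x. D - A \<subseteq> x \<and> x \<subseteq> (D - A) \<union> (y \<inter> A) \<and> card x = r}"
        using y less.prems by auto
      also have "card \<dots> = (card ((D - A) \<union> (y \<inter> A)) - card (D - A)) choose (r - card (D - A))"
        using fy fDA cD by (intro card_between) auto
      also have "card ((D - A) \<union> (y \<inter> A)) = card (D - A) + card (y \<inter> A)"
        using fy fDA by (intro card_Un_disjoint) auto
      also have "card (y \<inter> A) = s - card (y - A)"
        using y fy card_Int_Diff[of y A] by simp
      also have "y - A = y \<union> A - A" by auto
      finally show ?thesis by simp
    qed
    have "(\<Sum>x\<in>?R. \<Sum>y | x \<subseteq> y \<and> y \<subseteq> X \<and> card y = s. e y) =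
      (\<Sum>(x, y)\<in>Sigma ?R (\<lambda>x. {y. x \<subseteq> y \<and> y \<subseteq> X \<and> card y = s}). e y)"
      using X fz by (intro sum.Sigma) (auto intro!: fin)
    also have "\<dots> = (\<Sum>(y, x)\<in>Sigma {y. y \<subseteq> X \<and> card y = s \<and> D \<subseteq> y \<union> A}
        (\<lambda>y. {x. x \<subseteq> X \<and> card x = r \<and> x \<union> A = D \<and> x \<subseteq> y}). e y)"
      by (rule sum.reindex_bij_witness[of _ prod.swap prod.swap]) auto
    also have "\<dots> = (\<Sum>y | y \<subseteq> X \<and> card y = s \<and> D \<subseteq> y \<union> A. of_nat (?N (y \<union> A)) *s e y)"
      using count
      by (subst sum.Sigma[symmetric]) (auto intro!: sum.cong fin simp: sum_constant_scale)
    also have "\<dots> = (\<Sum>E\<in>{E. D \<subseteq> E \<and> E \<subseteq> X}.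
        \<Sum>y | y \<in> {y. y \<subseteq> X \<and> card y = s \<and> D \<subseteq> y \<union> A} \<and> y \<union> A = E. of_nat (?N (y \<union> A)) *s e y)"
      using A by (intro sum.group[symmetric]) (auto intro!: fin)
    also have "\<dots> = (\<Sum>E\<in>{E. D \<subseteq> E \<and> E \<subseteq> X}. of_nat (?N E) *s u E)"
      unfolding u_def scale_sum_right by (intro sum.cong) auto
    also have "{E. D \<subseteq> E \<and> E \<subseteq> X} = insert D {E. D \<subset> E \<and> E \<subseteq> X}"
      using less.prems by auto
    also have "(\<Sum>E\<in>insert D {E. D \<subset> E \<and> E \<subseteq> X}. of_nat (?N E) *s u E) =
       of_nat (?N D) *s u D + (\<Sum>E | D \<subset> E \<and> E \<subseteq> X. of_nat (?N E) *s u E)"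
      by (subst sum.insert) (auto intro!: fin)
    \<comment> \<open>The term of \<open>D\<close> is isolated; strict supersets have smaller
      complements in \<open>X\<close> and are covered by induction.\<close>
    finally have eq: "of_nat (?N D) *s u D =
        (\<Sum>x\<in>?R. \<Sum>y | x \<subseteq> y \<and> y \<subseteq> X \<and> card y = s. e y) -
        (\<Sum>E | D \<subset> E \<and> E \<subseteq> X. of_nat (?N E) *s u E)" by (simp add: algebra_simps)
    have "(\<Sum>x\<in>?R. \<Sum>y | x \<subseteq> y \<and> y \<subseteq> X \<and> card y = s. e y) \<in> S"
      by (rule subspace_sum[OF S(1)]) (use S(2) in auto)
    moreover have "(\<Sum>E | D \<subset> E \<and> E \<subseteq> X. of_nat (?N E) *s u E) \<in> S"
    proof (rule subspace_sum[OF S(1)])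
      fix E assume "E \<in> {E. D \<subset> E \<and> E \<subseteq> X}"
      then have "u E \<in> S"
        using less.prems X by (intro less.hyps psubset_card_mono) auto
      then show "of_nat (?N E) *s u E \<in> S" by (rule subspace_scale[OF S(1)])
    qed
    ultimately have "of_nat (?N D) *s u D \<in> S"
      unfolding eq using S(1) by (intro subspace_diff)
    moreover have "of_nat (?N D) \<noteq> (0::'a)"
    proof (rule of_nat_choose_neq_0[OF char])
      show "s - card (D - A) \<le> m" using X A card_mono[of X A] by simp
    qed (use rs in auto)
    ultimately show ?case
      using subspace_scale[OF S(1), of "of_nat (?N D) *s u D" "inverse (of_nat (?N D))"] by simp
  qed
  moreover have "u A = e A"
  proof -
    have "y = A" if "card y = s" "y \<union> A = A" for y
      by (rule card_subset_eq[OF fA]) (use that A in auto)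
    then have "{y. y \<subseteq> X \<and> card y = s \<and> y \<union> A = A} = {A}"
      using A by blast
    then show ?thesis by (simp add: u_def)
  qed
  ultimately show ?thesis using A(1) by (metis order_refl)
qed

section \<open>Faces and brackets\<close>

lemma bar_bar [simp]: "bar (bar v) = v"
  by (simp add: bar_def)

lemma bar_notin_Vdot: "v \<in> Vdot n \<Longrightarrow> bar v \<notin> Vdot n"
  by (auto simp: Vdot_def bar_def)

lemma inj_on_bar: "inj_on bar A"
  by (metis bar_bar inj_onI)

lemma finite_Vdot [simp]: "finite (Vdot n)"
  by (simp add: Vdot_def)

lemma card_Vdot [simp]: "card (Vdot n) = n"
  by (simp add: Vdot_def)

lemma finite_subset_Vdot: "U \<subseteq> Vdot n \<Longrightarrow> finite U"
  using finite_subset by fastforce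

section \<open>Encoding faces by support and signs\<close>

text \<open>A face is recorded by its support \<open>U\<close> in \<open>Vdot n\<close> and the set
  \<open>N\<close> of support points replaced by their antipodes. Statements on faces thus become
  statements on pairs of subsets.\<close>

definition mface :: "vertex set \<Rightarrow> vertex set \<Rightarrow> vertex set" where
  "mface U N = (U - N) \<union> bar ` N"

lemma mem_mface:
  assumes "U \<subseteq> Vdot n" "N \<subseteq> U" "v \<in> Vdot n"
  shows "v \<in> mface U N \<longleftrightarrow> v \<in> U - N" "bar v \<in> mface U N \<longleftrightarrow> v \<in> N"
proof -
  show "v \<in> mface U N \<longleftrightarrow> v \<in> U - N"
    using assms bar_notin_Vdot by (auto simp: mface_def)
  have "bar v \<in> bar ` N \<longleftrightarrow> v \<in> N"
    using inj_on_bar[of UNIV] by (simp add: inj_image_mem_iff)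
  then show "bar v \<in> mface U N \<longleftrightarrow> v \<in> N"
    using assms bar_notin_Vdot[OF assms(3)] by (auto simp: mface_def)
qed

lemma mface_disjoint: "U \<subseteq> Vdot n \<Longrightarrow> N \<subseteq> U \<Longrightarrow> (U - N) \<inter> bar ` N = {}"
  using bar_notin_Vdot by fastforce

lemma card_mface:
  assumes "U \<subseteq> Vdot n" "N \<subseteq> U"
  shows "card (mface U N) = card U"
proof -
  have fin: "finite U" "finite N"
    using assms finite_subset_Vdot by (auto intro: finite_subset_Vdot)
  have "card (mface U N) = card (U - N) + card (bar ` N)"
    unfolding mface_def using fin mface_disjoint[OF assms] by (intro card_Un_disjoint) auto
  then show ?thesis
    using fin assms by (simp add: card_image[OF inj_on_bar] card_Diff_subset card_mono)
qed

lemma finite_mface: "U \<subseteq> Vdot n \<Longrightarrow> N \<subseteq> U \<Longrightarrow> finite (mface U N)"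
  using finite_subset_Vdot[of U n] by (auto simp: mface_def intro: finite_subset)

text \<open>Membership of \<open>v\<close> and of \<open>bar v\<close> in the face recovers
  \<open>U - N\<close> and \<open>N\<close>. The predicate \<open>P\<close> is left free to cover
  both supports of fixed size and arbitrary ones.\<close>

lemma inj_on_mface: "inj_on (\<lambda>(U, N). mface U N) (SIGMA U:{U. U \<subseteq> Vdot n \<and> P U}. Pow U)"
proof (rule inj_onI, clarify)
  fix U N U' N'
  assume *: "U \<subseteq> Vdot n" "N \<subseteq> U" "U' \<subseteq> Vdot n" "N' \<subseteq> U'" "mface U N = mface U' N'"
  have "v \<in> N \<longleftrightarrow> v \<in> N'" "v \<in> U - N \<longleftrightarrow> v \<in> U' - N'" if "v \<in> Vdot n" for v
    using mem_mface[OF *(1,2) that] mem_mface[OF *(3,4) that] *(5) by auto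
  then have "N = N'" "U - N = U' - N'" using *(1-4) by blast+
  then show "U = U' \<and> N = N'" using *(2,4) by blast
qed

text \<open>A face takes from each antipodal pair \<open>v\<close>, or \<open>bar v\<close>, or
  nothing: \<open>N\<close> collects the second case and \<open>U\<close> the first two.\<close>

lemma Ln_eq_mface:
  "Ln n k = (\<lambda>(U, N). mface U N) ` (SIGMA U:{U. U \<subseteq> Vdot n \<and> card U = k}. Pow U)"
proof (intro equalityI subsetI)
  fix x assume x: "x \<in> Ln n k"
  define U where "U = {v \<in> Vdot n. v \<in> x \<or> bar v \<in> x}"
  define N where "N = {v \<in> Vdot n. bar v \<in> x}"
  have sub: "U \<subseteq> Vdot n" "N \<subseteq> U" by (auto simp: U_def N_def)
  have "\<not> (v \<in> x \<and> bar v \<in> x)" if "v \<in> Vdot n" for v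
  proof
    assume "v \<in> x \<and> bar v \<in> x"
    then have "x \<inter> {v, bar v} = {v, bar v}" by auto
    moreover have "v \<noteq> bar v" by (simp add: bar_def prod_eq_iff)
    ultimately have "card (x \<inter> {v, bar v}) = 2" by simp
    then show False using x that by (fastforce simp: Ln_def)
  qed
  then have "v \<in> x \<longleftrightarrow> v \<in> mface U N" "bar v \<in> x \<longleftrightarrow> bar v \<in> mface U N" if "v \<in> Vdot n" for v
    using mem_mface[OF sub that] that unfolding U_def N_def by blast+
  moreover have "x \<subseteq> Vdot n \<union> bar ` Vdot n" "mface U N \<subseteq> Vdot n \<union> bar ` Vdot n"
    using x sub by (auto simp: Ln_def Vn_def mface_def)
  ultimately have "x = mface U N" by blast
  moreover have "card U = k" using card_mface[OF sub] \<open>x = mface U N\<close> x by (simp add: Ln_def)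
  ultimately show "x \<in> (\<lambda>(U, N). mface U N) ` (SIGMA U:{U. U \<subseteq> Vdot n \<and> card U = k}. Pow U)"
    using sub by force
next
  fix x assume "x \<in> (\<lambda>(U, N). mface U N) ` (SIGMA U:{U. U \<subseteq> Vdot n \<and> card U = k}. Pow U)"
  then obtain U N where x: "x = mface U N" and U: "U \<subseteq> Vdot n" "card U = k" "N \<subseteq> U" by auto
  have "card (x \<inter> {v, bar v}) \<le> 1" if "v \<in> Vdot n" for v
  proof -
    have "x \<inter> {v, bar v} = {v} \<or> x \<inter> {v, bar v} = {bar v} \<or> x \<inter> {v, bar v} = {}"
      using mem_mface[OF U(1,3) that] x by auto
    then show ?thesis by (elim disjE) simp_all
  qed
  moreover have "x \<subseteq> Vn n" using U by (auto simp: x mface_def Vn_def)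
  ultimately show "x \<in> Ln n k" using card_mface[OF U(1,3)] U x by (auto simp: Ln_def)
qed

lemma mface_in_Ln: "U \<subseteq> Vdot n \<Longrightarrow> N \<subseteq> U \<Longrightarrow> mface U N \<in> Ln n (card U)"
  by (auto simp: Ln_eq_mface)

lemma card_Ln: "card (Ln n k) = (n choose k) * 2 ^ k"
proof -
  have "card (Ln n k) = card (SIGMA U:{U. U \<subseteq> Vdot n \<and> card U = k}. Pow U)"
    unfolding Ln_eq_mface by (rule card_image[OF inj_on_mface])
  also have "\<dots> = (\<Sum>U | U \<subseteq> Vdot n \<and> card U = k. 2 ^ k)"
  proof (subst card_SigmaI)
    show "(\<Sum>U | U \<subseteq> Vdot n \<and> card U = k. card (Pow U)) = (\<Sum>U | U \<subseteq> Vdot n \<and> card U = k. 2 ^ k)"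
      using finite_subset_Vdot by (intro sum.cong) (auto simp: card_Pow)
  qed (use finite_subset_Vdot[of _ n] in auto)
  also have "\<dots> = (n choose k) * 2 ^ k"
    using n_subsets[OF finite_Vdot[of n], of k] by simp
  finally show ?thesis .
qed

lemma face_Un:
  assumes "finite x" "finite y" "x \<inter> y = {}"
  shows "face (x \<union> y) = (face x * face y :: 'f::field vpoly)"
  using assms by (simp add: face_def mset_set_Union mult_single)

lemma face_mface:
  assumes "U \<subseteq> Vdot n" "N \<subseteq> U"
  shows "(face (mface U N) :: 'f::field vpoly) = (\<Prod>v\<in>U. if v \<in> N then var (bar v) else var v)"
proof -
  have fin: "finite U" "finite N"
    using assms by (auto intro: finite_subset_Vdot)
  have "(face (mface U N) :: 'f vpoly) = face (U - N) * face (bar ` N)"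
    unfolding mface_def using fin mface_disjoint[OF assms] by (intro face_Un) auto
  also have "\<dots> = (\<Prod>v\<in>U - N. var v) * (\<Prod>v\<in>N. var (bar v))"
    using fin by (simp add: face_eq_prod prod.reindex[OF inj_on_bar])
  also have "\<dots> = (\<Prod>v\<in>U - N. if v \<in> N then var (bar v) else var v) *
      (\<Prod>v\<in>N. if v \<in> N then var (bar v) else var v)"
    by simp
  also have "\<dots> = (\<Prod>v\<in>U. if v \<in> N then var (bar v) else var v)"
    using assms fin by (intro prod.subset_diff[symmetric])
  finally show ?thesis .
qed

section \<open>Change of basis between faces and brackets\<close>

lemma vscale_mult: "vscale c p * q = (vscale c (p * q) :: 'f::field vpoly)"
  by (simp add: vscale_def mult_map_scale_conv_mult mult.assoc)

text \<open>Multiplication is bilinear, so generators suffice: span induction runs on one factor and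
  then, by commutativity, on the other.\<close>

lemma span_mult:
  fixes p q :: "'f::field vpoly"
  assumes "p \<in> vp.span S" "q \<in> vp.span T"
    and "\<And>x y. x \<in> S \<Longrightarrow> y \<in> T \<Longrightarrow> x * y \<in> vp.span R"
  shows "p * q \<in> vp.span R"
proof -
  have sub: "vp.subspace {p. p * r \<in> vp.span R}" for r
    by (rule vp.subspaceI)
       (auto simp: vp.span_zero distrib_right vp.span_add vscale_mult vp.span_scale)
  have 1: "x * y \<in> vp.span R" if "x \<in> vp.span S" "y \<in> T" for x y
    using vp.span_induct[OF that(1) sub[of y]] assms(3) that(2) by blast
  have "q * p \<in> vp.span R"
    by (rule vp.span_induct[OF assms(2) sub[of p]]) (use 1[OF assms(1)] in \<open>simp add: mult.commute\<close>)
  then show ?thesis by (simp add: mult.commute)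
qed

text \<open>Here and in \<open>brackets_over\<close> the elements are products with one factor per
  vertex of the support \<open>U\<close>. Comparing the two spans factor by factor reduces the
  change of basis to a single antipodal pair.\<close>

definition faces_over :: "vertex set \<Rightarrow> 'f::field vpoly set" where
  "faces_over U = {face (mface U N) | N. N \<subseteq> U}"

definition brackets_over :: "vertex set \<Rightarrow> 'f::field vpoly set" where
  "brackets_over U = {bracket a b | a b. a \<inter> b = {} \<and> a \<union> b = U}"

text \<open>Isolates the induction that adds one vertex at a time; \<open>S A\<close> stands for a
  span of products with support \<open>A\<close>. It serves both directions of the change of
  basis.\<close>

lemma prod_in_graded_family:
  fixes S :: "'a set \<Rightarrow> 'b::comm_monoid_mult set"
  assumes "finite U" "1 \<in> S {}"
    and "\<And>v A p q. v \<in> U \<Longrightarrow> A \<subseteq> U \<Longrightarrow> v \<notin> A \<Longrightarrow> p \<in> S {v} \<Longrightarrow> q \<in> S A \<Longrightarrow> p * q \<in> S (insert v A)"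
    and "\<And>v. v \<in> U \<Longrightarrow> g v \<in> S {v}"
  shows "(\<Prod>v\<in>U. g v) \<in> S U"
  using assms
proof (induction U rule: finite_induct)
  case (insert v U)
  have "(\<Prod>w\<in>U. g w) \<in> S U"
  proof (rule insert.IH)
    fix w A p q assume "w \<in> U" "A \<subseteq> U" "w \<notin> A" "p \<in> S {w}" "q \<in> S A"
    then show "p * q \<in> S (insert w A)" using insert.prems(2)[of w A p q] by blast
  qed (use insert.prems(1,3) in auto)
  then show ?case
    using insert.prems(2)[of v U "g v" "\<Prod>w\<in>U. g w"] insert.prems(3)[of v] insert.hyps by auto
qed auto

lemma bracket_eq_prod:
  assumes "finite a" "finite b" "a \<inter> b = {}"
  shows "(bracket a b :: 'f::field vpoly) = (\<Prod>v\<in>a \<union> b. if v \<in> b then var v - var (bar v) else var v + var (bar v))"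
proof -
  have "(\<Prod>v\<in>a. if v \<in> b then var v - var (bar v) else var v + var (bar v)) =
      (\<Prod>v\<in>a. var v + var (bar v) :: 'f vpoly)"
    using assms by (intro prod.cong) auto
  moreover have "(\<Prod>v\<in>b. if v \<in> b then var v - var (bar v) else var v + var (bar v)) =
      (\<Prod>v\<in>b. var v - var (bar v) :: 'f vpoly)"
    by (intro prod.cong) auto
  ultimately show ?thesis by (simp only: bracket_def prod.union_disjoint[OF assms])
qed

lemma bracket_mult:
  assumes "finite a" "finite a'" "finite b" "finite b'" "a \<inter> a' = {}" "b \<inter> b' = {}"
  shows "bracket a b * bracket a' b' = bracket (a \<union> a') (b \<union> b')"
  using assms by (simp add: bracket_def prod.union_disjoint mult_ac)

text \<open>Each factor of the bracket lies in the span of the two faces over \<open>{v}\<close>,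
  and the product of faces with disjoint supports is again a face.\<close>

lemma bracket_in_span_faces_over:
  assumes "a \<union> b \<subseteq> Vdot n" "a \<inter> b = {}"
  shows "bracket a b \<in> vp.span (faces_over (a \<union> b) :: 'f::field vpoly set)"
proof -
  have fin: "finite a" "finite b" using assms by (auto intro: finite_subset_Vdot)
  have var: "var v \<in> vp.span (faces_over {v} :: 'f vpoly set)"
    "var (bar v) \<in> vp.span (faces_over {v} :: 'f vpoly set)" for v
  proof -
    have "(var v :: 'f vpoly) = face (mface {v} {})" "(var (bar v) :: 'f vpoly) = face (mface {v} {v})"
      by (simp_all add: mface_def face_def var_def)
    then show "var v \<in> vp.span (faces_over {v} :: 'f vpoly set)"
      "var (bar v) \<in> vp.span (faces_over {v} :: 'f vpoly set)"
      unfolding faces_over_def by (blast intro: vp.span_base)+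
  qed
  show ?thesis
    unfolding bracket_eq_prod[OF fin assms(2)]
  proof (rule prod_in_graded_family)
    show "1 \<in> vp.span (faces_over {} :: 'f vpoly set)"
      by (auto simp: faces_over_def mface_def face_def intro!: vp.span_base)
    fix v A and p q :: "'f vpoly"
    assume *: "v \<in> a \<union> b" "A \<subseteq> a \<union> b" "v \<notin> A" "p \<in> vp.span (faces_over {v})" "q \<in> vp.span (faces_over A)"
    show "p * q \<in> vp.span (faces_over (insert v A))"
    proof (rule span_mult[OF *(4,5)])
      fix x y :: "'f vpoly" assume "x \<in> faces_over {v}" "y \<in> faces_over A"
      then obtain N M where xy: "x = face (mface {v} N)" "y = face (mface A M)" "N \<subseteq> {v}" "M \<subseteq> A"
        unfolding faces_over_def by blast
      have sub: "insert v A \<subseteq> Vdot n" "N \<union> M \<subseteq> insert v A" using * assms xy by auto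
      \<comment> \<open>Since \<open>v \<notin> A\<close>, the common sign set
        \<open>N \<union> M\<close> agrees with \<open>N\<close> on \<open>{v}\<close> and with
        \<open>M\<close> on \<open>A\<close>, so both products can use the same factors.\<close>
      have "x * y = (\<Prod>w\<in>{v}. if w \<in> N \<union> M then var (bar w) else var w) *
          (\<Prod>w\<in>A. if w \<in> N \<union> M then var (bar w) else var w)"
      proof -
        have "x = (\<Prod>w\<in>{v}. if w \<in> N \<union> M then var (bar w) else var w)"
          using xy * sub by (subst xy(1), subst face_mface[of _ n]) auto
        moreover have "y = (\<Prod>w\<in>A. if w \<in> N \<union> M then var (bar w) else var w)"
          using xy * sub by (subst xy(2), subst face_mface[of _ n]) (auto intro!: prod.cong)
        ultimately show ?thesis by simp
      qed
      also have "\<dots> = (\<Prod>w\<in>insert v A. if w \<in> N \<union> M then var (bar w) else var w)"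
        using sub *(3) finite_subset_Vdot[of A n] by simp
      also have "\<dots> = face (mface (insert v A) (N \<union> M))"
        using sub by (intro face_mface[symmetric])
      finally show "x * y \<in> vp.span (faces_over (insert v A))"
        using sub by (auto simp: faces_over_def intro!: vp.span_base)
    qed
  qed (use fin in \<open>auto intro: vp.span_diff vp.span_add var\<close>)
qed

text \<open>When 2 is invertible, \<open>var v\<close> and \<open>var (bar v)\<close> are half the
  sum and half the difference of \<open>bracket {v} {}\<close> and
  \<open>bracket {} {v}\<close>.\<close>

lemma face_in_span_brackets_over:
  assumes "U \<subseteq> Vdot n" "N \<subseteq> U" and two: "(2::'f::field) \<noteq> 0"
  shows "face (mface U N) \<in> vp.span (brackets_over U :: 'f vpoly set)"
proof -
  have gen: "bracket {v} {} \<in> vp.span (brackets_over {v} :: 'f vpoly set)"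
    "bracket {} {v} \<in> vp.span (brackets_over {v} :: 'f vpoly set)" for v
    by (intro vp.span_base; unfold brackets_over_def, force)+
  have var: "var v \<in> vp.span (brackets_over {v} :: 'f vpoly set)"
    "var (bar v) \<in> vp.span (brackets_over {v} :: 'f vpoly set)" for v
  proof -
    have half: "vscale (inverse 2) (p + p) = p" for p :: "'f vpoly"
    proof (rule poly_mapping_eqI)
      fix m
      have "inverse 2 * (x + x) = x" for x :: 'f
        using two by (simp add: mult_2[symmetric] del: mult_2)
      then show "Poly_Mapping.lookup (vscale (inverse 2) (p + p)) m = Poly_Mapping.lookup p m"
        by (simp only: lookup_vscale lookup_add)
    qed
    have "(var v :: 'f vpoly) = vscale (inverse 2) (bracket {v} {} + bracket {} {v})"
      using half[of "var v"] by (simp add: bracket_def)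
    moreover have "(var (bar v) :: 'f vpoly) = vscale (inverse 2) (bracket {v} {} - bracket {} {v})"
      using half[of "var (bar v)"] by (simp add: bracket_def)
    ultimately show "var v \<in> vp.span (brackets_over {v} :: 'f vpoly set)"
      "var (bar v) \<in> vp.span (brackets_over {v} :: 'f vpoly set)"
      using gen by (simp_all add: vp.span_scale vp.span_add vp.span_diff)
  qed
  show ?thesis
    unfolding face_mface[OF assms(1,2)]
  proof (rule prod_in_graded_family)
    show "1 \<in> vp.span (brackets_over {} :: 'f vpoly set)"
      by (auto simp: brackets_over_def bracket_def intro!: vp.span_base)
    fix v A and p q :: "'f vpoly"
    assume *: "v \<in> U" "A \<subseteq> U" "v \<notin> A" "p \<in> vp.span (brackets_over {v})" "q \<in> vp.span (brackets_over A)"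
    have fA: "finite A" using *(2) assms(1) by (auto intro: finite_subset_Vdot)
    show "p * q \<in> vp.span (brackets_over (insert v A))"
    proof (rule span_mult[OF *(4,5)])
      fix x y :: "'f vpoly" assume "x \<in> brackets_over {v}" "y \<in> brackets_over A"
      then obtain a b a' b' where xy: "x = bracket a b" "y = bracket a' b'"
        "a \<inter> b = {}" "a \<union> b = {v}" "a' \<inter> b' = {}" "a' \<union> b' = A"
        unfolding brackets_over_def by blast
      have "x * y = bracket (a \<union> a') (b \<union> b')"
        unfolding xy(1,2)
      proof (rule bracket_mult)
        show "finite a" "finite b" "finite a'" "finite b'"
          using xy(4,6) fA by (metis finite.emptyI finite.insertI finite_Un)+
      qed (use xy *(3) in auto)
      moreover have "(a \<union> a') \<inter> (b \<union> b') = {}" "(a \<union> a') \<union> (b \<union> b') = insert v A"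
        using xy *(3) by auto
      ultimately show "x * y \<in> vp.span (brackets_over (insert v A))"
        unfolding brackets_over_def by (intro vp.span_base) blast
    qed
  qed (use assms in \<open>auto intro: var finite_subset_Vdot\<close>)
qed

section \<open>The inclusion map on brackets\<close>

text \<open>Expanding the product selects one vertex from each pair; \<open>M\<close> is the set of
  places where the antipode is selected.\<close>

lemma sum_faces_over:
  assumes "c \<subseteq> Vdot n"
  shows "(\<Sum>M\<in>Pow c. face (mface c M)) = (bracket c {} :: 'f::field vpoly)"
proof -
  have fin: "finite c" using assms by (rule finite_subset_Vdot)
  have "(bracket c {} :: 'f vpoly) = (\<Prod>v\<in>c. var (bar v) + var v)"
    by (simp add: bracket_def add.commute)
  also have "\<dots> = (\<Sum>M\<in>Pow c. (\<Prod>v\<in>M. var (bar v)) * (\<Prod>v\<in>c - M. var v))"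
    using fin by (rule prod_add)
  also have "\<dots> = (\<Sum>M\<in>Pow c. face (mface c M))"
  proof (rule sum.cong)
    fix M assume "M \<in> Pow c"
    then have M: "M \<subseteq> c" "finite M" using fin finite_subset by auto
    have "(face (mface c M) :: 'f vpoly) = face (c - M) * face (bar ` M)"
      unfolding mface_def using fin M mface_disjoint[OF assms M(1)] by (intro face_Un) auto
    then show "(\<Prod>v\<in>M. var (bar v)) * (\<Prod>v\<in>c - M. var v) = (face (mface c M) :: 'f vpoly)"
      using fin M by (simp add: face_eq_prod prod.reindex[OF inj_on_bar] mult.commute)
  qed simp
  finally show ?thesis by simp
qed

lemma mface_Un:
  "U \<inter> M = {} \<Longrightarrow> c \<inter> N = {} \<Longrightarrow> mface (U \<union> c) (N \<union> M) = mface U N \<union> mface c M"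
  by (auto simp: mface_def)

text \<open>A \<open>k\<close>-face above \<open>mface U N\<close> adds a disjoint support
  \<open>c\<close> with arbitrary signs, and summing over the signs gives
  \<open>bracket c {}\<close>. The multiplier so obtained depends on the support \<open>U\<close>
  but not on the signs \<open>N\<close>.\<close>

lemma eps_mface:
  assumes "U \<subseteq> Vdot n" "N \<subseteq> U" "card U = t" "t \<le> k"
  shows "(eps n t k (face (mface U N)) :: 'f::field vpoly) =
    face (mface U N) * (\<Sum>c | c \<subseteq> Vdot n - U \<and> card c = k - t. bracket c {})"
proof -
  let ?C = "{c. c \<subseteq> Vdot n - U \<and> card c = k - t}"
  have finC: "finite ?C" by (rule finite_subset[of _ "Pow (Vdot n)"]) auto
  have finU: "finite U" using assms(1) by (rule finite_subset_Vdot)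
  have "(eps n t k (face (mface U N)) :: 'f vpoly) = (\<Sum>y | y \<in> Ln n k \<and> mface U N \<subseteq> y. face y)"
    using assms mface_in_Ln[OF assms(1,2)] by (intro eps_face) simp
  also have "{y. y \<in> Ln n k \<and> mface U N \<subseteq> y} = (\<lambda>(c, M). mface (U \<union> c) (N \<union> M)) ` Sigma ?C Pow"
  proof (intro equalityI subsetI)
    fix y assume "y \<in> {y. y \<in> Ln n k \<and> mface U N \<subseteq> y}"
    then obtain W K where y: "y = mface W K" "W \<subseteq> Vdot n" "card W = k" "K \<subseteq> W" "mface U N \<subseteq> y"
      by (auto simp: Ln_eq_mface)
    have NK: "v \<in> N \<Longrightarrow> v \<in> K" "v \<in> U - N \<Longrightarrow> v \<in> W - K" for v
      using mem_mface[OF assms(1,2), of v] mem_mface[OF y(2,4), of v] y(1,5) assms(1,2) by blast+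
    have UW: "U \<subseteq> W" and K: "K = N \<union> (K - U)" using NK y(4) by blast+
    have "y = mface (U \<union> (W - U)) (N \<union> (K - U))"
      using UW K y(1) by (metis Un_Diff_cancel sup.absorb2)
    moreover have "card (W - U) = k - t" using UW y assms finU by (simp add: card_Diff_subset)
    ultimately show "y \<in> (\<lambda>(c, M). mface (U \<union> c) (N \<union> M)) ` Sigma ?C Pow"
      using y by (intro image_eqI[of _ _ "(W - U, K - U)"]) auto
  next
    fix y assume "y \<in> (\<lambda>(c, M). mface (U \<union> c) (N \<union> M)) ` Sigma ?C Pow"
    then obtain c M where y: "y = mface (U \<union> c) (N \<union> M)" "c \<subseteq> Vdot n - U" "card c = k - t" "M \<subseteq> c"
      by auto
    have "card (U \<union> c) = card U + card c"
      using y finU finite_subset_Vdot[of c n] by (intro card_Un_disjoint) auto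
    then have "card (U \<union> c) = k" using y assms by simp
    then have "y \<in> Ln n k" using mface_in_Ln[of "U \<union> c" n "N \<union> M"] y assms by auto
    moreover have "y = mface U N \<union> mface c M" using y assms by (subst y(1), intro mface_Un) auto
    ultimately show "y \<in> {y. y \<in> Ln n k \<and> mface U N \<subseteq> y}" by auto
  qed
  also have "(\<Sum>y\<in>(\<lambda>(c, M). mface (U \<union> c) (N \<union> M)) ` Sigma ?C Pow. face y :: 'f vpoly) =
     (\<Sum>(c, M)\<in>Sigma ?C Pow. face (mface (U \<union> c) (N \<union> M)))"
  proof (subst sum.reindex)
    show "inj_on (\<lambda>(c, M). mface (U \<union> c) (N \<union> M)) (Sigma ?C Pow)"
    proof (rule inj_onI, clarify)
      fix c M c' M'
      assume *: "c \<subseteq> Vdot n - U" "M \<subseteq> c" "c' \<subseteq> Vdot n - U" "M' \<subseteq> c'"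
        "mface (U \<union> c) (N \<union> M) = mface (U \<union> c') (N \<union> M')"
      have "(U \<union> c, N \<union> M) \<in> (SIGMA U:{U. U \<subseteq> Vdot n \<and> True}. Pow U)"
        "(U \<union> c', N \<union> M') \<in> (SIGMA U:{U. U \<subseteq> Vdot n \<and> True}. Pow U)"
        using * assms(1,2) by blast+
      then have "(U \<union> c, N \<union> M) = (U \<union> c', N \<union> M')"
        by (intro inj_onD[OF inj_on_mface[of n "\<lambda>_. True"]]) (use *(5) in simp_all)
      then show "c = c' \<and> M = M'" using * assms by blast
    qed
  qed (simp add: case_prod_beta')
  also have "\<dots> = (\<Sum>(c, M)\<in>Sigma ?C Pow. face (mface U N) * face (mface c M))"
  proof (intro sum.cong refl, clarify)
    fix c M assume *: "c \<subseteq> Vdot n - U" "M \<subseteq> c"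
    have "mface (U \<union> c) (N \<union> M) = mface U N \<union> mface c M"
      using * assms by (intro mface_Un) auto
    moreover have "mface U N \<inter> mface c M = {}"
    proof -
      have "v \<notin> mface U N \<inter> mface c M \<and> bar v \<notin> mface U N \<inter> mface c M" if "v \<in> Vdot n" for v
        using mem_mface[OF assms(1,2) that] mem_mface[of c n M, OF _ _ that] * assms(1,2) by blast
      moreover have "mface U N \<subseteq> Vn n" using mface_in_Ln[OF assms(1,2)] by (auto simp: Ln_def)
      ultimately show ?thesis by (auto simp: Vn_def)
    qed
    ultimately show "face (mface (U \<union> c) (N \<union> M)) = (face (mface U N) * face (mface c M) :: 'f vpoly)"
      using face_Un[of "mface U N" "mface c M"] finite_mface[OF assms(1,2)] finite_mface[of c n M] *
      by auto
  qed
  also have "\<dots> = (\<Sum>c\<in>?C. \<Sum>M\<in>Pow c. face (mface U N) * face (mface c M))"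
    using finC finite_subset_Vdot[of _ n] by (subst sum.Sigma) auto
  also have "\<dots> = (\<Sum>c\<in>?C. face (mface U N) * bracket c {})"
  proof (rule sum.cong[OF refl])
    fix c assume "c \<in> ?C"
    then have "c \<subseteq> Vdot n" by blast
    then show "(\<Sum>M\<in>Pow c. face (mface U N) * face (mface c M)) = face (mface U N) * (bracket c {} :: 'f vpoly)"
      using sum_faces_over[of c n, where 'f='f] by (simp add: sum_distrib_left[symmetric])
  qed
  finally show ?thesis by (simp add: sum_distrib_left)
qed

text \<open>On all faces with support \<open>a \<union> b\<close> the map is multiplication by one
  fixed polynomial, hence also on \<open>bracket a b\<close> in their span. Each factor
  \<open>bracket c {}\<close> enlarges \<open>a\<close> and leaves \<open>b\<close>
  unchanged.\<close>

lemma eps_bracket: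
  assumes "a \<subseteq> Vdot n" "b \<subseteq> Vdot n" "a \<inter> b = {}" "card a + card b = t" "t \<le> k"
  shows "(eps n t k (bracket a b) :: 'f::field vpoly) =
    (\<Sum>a' | a \<subseteq> a' \<and> a' \<subseteq> Vdot n - b \<and> card a' = k - card b. bracket a' b)"
proof -
  have fin: "finite a" "finite b" using assms by (auto intro: finite_subset_Vdot)
  have card: "card (a \<union> b) = t" using fin assms by (simp add: card_Un_disjoint)
  let ?C = "{c. c \<subseteq> Vdot n - (a \<union> b) \<and> card c = k - t}"
  let ?q = "\<Sum>c\<in>?C. bracket c {} :: 'f vpoly"
  interpret eps: Vector_Spaces.linear vscale vscale "eps n t k :: 'f vpoly \<Rightarrow> 'f vpoly"
    by (rule linear_eps)
  have "vp.subspace {p. eps n t k p = p * ?q}"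
    by (rule vp.subspaceI) (auto simp: eps.zero eps.add eps.scale distrib_right vscale_mult)
  then have "eps n t k (bracket a b) = (bracket a b * ?q :: 'f vpoly)"
  proof (rule vp.span_induct[OF bracket_in_span_faces_over[of a b n], rotated 2])
    fix x :: "'f vpoly" assume "x \<in> faces_over (a \<union> b)"
    then obtain N where "x = face (mface (a \<union> b) N)" "N \<subseteq> a \<union> b"
      unfolding faces_over_def by blast
    then show "eps n t k x = x * ?q"
      using assms card eps_mface[of "a \<union> b" n N t k] by simp
  qed (use assms in auto)
  also have "\<dots> = (\<Sum>c\<in>?C. bracket (a \<union> c) b)"
    unfolding sum_distrib_left
  proof (intro sum.cong refl)
    fix c assume "c \<in> ?C"
    then show "bracket a b * bracket c {} = (bracket (a \<union> c) b :: 'f vpoly)"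
      using fin finite_subset_Vdot[of c n] by (subst bracket_mult) auto
  qed
  also have "\<dots> = (\<Sum>a' | a \<subseteq> a' \<and> a' \<subseteq> Vdot n - b \<and> card a' = k - card b. bracket a' b)"
  proof (rule sum.reindex_bij_witness[of _ "\<lambda>a'. a' - a" "\<lambda>c. a \<union> c"])
    fix c assume c: "c \<in> ?C"
    then have "card (a \<union> c) = card a + card c"
      using fin finite_subset_Vdot[of c n] by (intro card_Un_disjoint) auto
    then show "a \<union> c \<in> {a'. a \<subseteq> a' \<and> a' \<subseteq> Vdot n - b \<and> card a' = k - card b}"
      using c assms by auto
  qed (use assms fin in \<open>auto simp: card_Diff_subset\<close>)
  finally show ?thesis .
qed

section \<open>The subspaces $E_{s,j}$\<close>

text \<open>Indexing by pairs keeps the counting independent of the field; that distinct pairs yield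
  distinct brackets is a separate fact.\<close>

definition bracket_pairs :: "nat \<Rightarrow> nat \<Rightarrow> nat \<Rightarrow> (vertex set \<times> vertex set) set" where
  "bracket_pairs n s j = {(a, b). a \<subseteq> Vdot n \<and> b \<subseteq> Vdot n \<and> a \<inter> b = {} \<and> card a = s - j \<and> card b = j}"

definition brackets :: "nat \<Rightarrow> nat \<Rightarrow> nat \<Rightarrow> 'f::field vpoly set" where
  "brackets n s j = case_prod bracket ` bracket_pairs n s j"

lemma En_eq: "En n s j = vp.span (brackets n s j)"
  unfolding En_def brackets_def bracket_pairs_def
  by (rule arg_cong[where f = vp.span]) (auto simp: image_def)

lemma finite_bracket_pairs: "finite (bracket_pairs n s j)"
  by (rule finite_subset[of _ "Pow (Vdot n) \<times> Pow (Vdot n)"]) (auto simp: bracket_pairs_def)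

text \<open>Choosing \<open>b\<close> first and then \<open>a\<close> in its complement gives
  \<open>(n choose j) * ((n - j) choose (s - j))\<close>.\<close>

lemma card_bracket_pairs:
  assumes "j \<le> s" "s \<le> n"
  shows "card (bracket_pairs n s j) = (n choose s) * (s choose j)"
proof -
  let ?S = "SIGMA b:{b. b \<subseteq> Vdot n \<and> card b = j}. {a. a \<subseteq> Vdot n - b \<and> card a = s - j}"
  have "bracket_pairs n s j = prod.swap ` ?S"
    by (auto simp: bracket_pairs_def image_iff)
  then have "card (bracket_pairs n s j) = card ?S"
    by (simp add: card_image)
  also have "\<dots> = (\<Sum>b | b \<subseteq> Vdot n \<and> card b = j. (n - j) choose (s - j))"
  proof (subst card_SigmaI)
    show "(\<Sum>b | b \<subseteq> Vdot n \<and> card b = j. card {a. a \<subseteq> Vdot n - b \<and> card a = s - j}) =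
       (\<Sum>b | b \<subseteq> Vdot n \<and> card b = j. (n - j) choose (s - j))"
    proof (rule sum.cong[OF refl])
      fix b assume "b \<in> {b. b \<subseteq> Vdot n \<and> card b = j}"
      then show "card {a. a \<subseteq> Vdot n - b \<and> card a = s - j} = (n - j) choose (s - j)"
        using n_subsets[of "Vdot n - b" "s - j"] finite_subset_Vdot[of b n]
        by (simp add: card_Diff_subset)
    qed
  qed auto
  also have "\<dots> = (n choose j) * ((n - j) choose (s - j))"
    using n_subsets[OF finite_Vdot[of n], of j] by simp
  also have "\<dots> = (n choose s) * (s choose j)"
    using choose_mult[OF assms] by simp
  finally show ?thesis .
qed

text \<open>This equals the number of \<open>s\<close>-faces, which is what makes a spanning family
  of brackets a basis.\<close>

lemma card_Union_bracket_pairs: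
  assumes "s \<le> n"
  shows "card (\<Union>j\<le>s. bracket_pairs n s j) = (n choose s) * 2 ^ s"
proof -
  have "card (\<Union>j\<le>s. bracket_pairs n s j) = (\<Sum>j\<le>s. card (bracket_pairs n s j))"
    by (rule card_UN_disjoint) (auto simp: finite_bracket_pairs, auto simp: bracket_pairs_def)
  also have "\<dots> = (n choose s) * (\<Sum>j\<le>s. s choose j)"
    using assms by (simp add: card_bracket_pairs sum_distrib_left)
  finally show ?thesis by (simp add: choose_row_sum)
qed

lemma face_basis_subset_span_brackets:
  assumes "(2::'f::field) \<noteq> 0"
  shows "(face_basis n s :: 'f vpoly set) \<subseteq> vp.span (\<Union>j\<le>s. brackets n s j)"
proof
  fix x :: "'f vpoly" assume "x \<in> face_basis n s"
  then obtain U N where x: "x = face (mface U N)" and U: "U \<subseteq> Vdot n" "card U = s" "N \<subseteq> U"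
    by (auto simp: face_basis_def Ln_eq_mface)
  have "brackets_over U \<subseteq> (\<Union>j\<le>s. brackets n s j :: 'f vpoly set)"
  proof
    fix y :: "'f vpoly" assume "y \<in> brackets_over U"
    then obtain a b where y: "y = bracket a b" "a \<inter> b = {}" "a \<union> b = U"
      unfolding brackets_over_def by blast
    have "finite a" "finite b" using y U finite_subset_Vdot[of U n] by (metis finite_Un)+
    then have "card a + card b = s" using y U card_Un_disjoint by metis
    then have "(a, b) \<in> bracket_pairs n s (card b)" "card b \<le> s"
      using y U by (auto simp: bracket_pairs_def)
    then show "y \<in> (\<Union>j\<le>s. brackets n s j)" using y by (force simp: brackets_def)
  qed
  then show "x \<in> vp.span (\<Union>j\<le>s. brackets n s j)"
    using face_in_span_brackets_over[OF U(1,3) assms] vp.span_mono x by blast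
qed

lemma brackets_subset_Mn:
  assumes "j \<le> s"
  shows "(brackets n s j :: 'f::field vpoly set) \<subseteq> Mn n s"
proof
  fix x :: "'f vpoly" assume "x \<in> brackets n s j"
  then obtain a b where x: "x = bracket a b" "a \<union> b \<subseteq> Vdot n" "a \<inter> b = {}"
    "card a = s - j" "card b = j"
    by (auto simp: brackets_def bracket_pairs_def)
  have "card (a \<union> b) = card a + card b"
    using x finite_subset_Vdot[of a n] finite_subset_Vdot[of b n] by (intro card_Un_disjoint) auto
  then have "faces_over (a \<union> b) \<subseteq> (face_basis n s :: 'f vpoly set)"
    using mface_in_Ln[OF x(2)] x assms by (auto simp: faces_over_def face_basis_def)
  then show "x \<in> Mn n s"
    using bracket_in_span_faces_over[OF x(2,3)] vp.span_mono x(1) unfolding Mn_def by blast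
qed

lemma Mn_eq_span_brackets:
  assumes "(2::'f::field) \<noteq> 0"
  shows "(Mn n s :: 'f vpoly set) = vp.span (\<Union>j\<le>s. brackets n s j)"
proof
  show "Mn n s \<subseteq> (vp.span (\<Union>j\<le>s. brackets n s j) :: 'f vpoly set)"
    unfolding Mn_def
    by (rule vp.span_minimal[OF face_basis_subset_span_brackets[OF assms] vp.subspace_span])
  have "(\<Union>j\<le>s. brackets n s j) \<subseteq> (Mn n s :: 'f vpoly set)"
    using brackets_subset_Mn by blast
  then show "(vp.span (\<Union>j\<le>s. brackets n s j) :: 'f vpoly set) \<subseteq> Mn n s"
    unfolding Mn_def by (intro vp.span_minimal) auto
qed

text \<open>The span of the brackets contains the face basis, and there are as many index pairs as
  faces, so \<open>independent_family_if_spanning\<close> applies.\<close>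

lemma independent_Union_brackets:
  assumes "(2::'f::field) \<noteq> 0" "s \<le> n"
  shows "inj_on (case_prod bracket :: _ \<Rightarrow> 'f vpoly) (\<Union>j\<le>s. bracket_pairs n s j)"
    and "\<not> vp.dependent (\<Union>j\<le>s. brackets n s j :: 'f vpoly set)"
proof -
  let ?I = "\<Union>j\<le>s. bracket_pairs n s j"
  have img: "(\<Union>j\<le>s. brackets n s j :: 'f vpoly set) = case_prod bracket ` ?I"
    by (auto simp: brackets_def)
  have "finite ?I" by (simp add: finite_bracket_pairs)
  moreover have "card (face_basis n s :: 'f vpoly set) = card ?I"
    using assms(2) by (simp add: face_basis_def card_image[OF inj_on_face] card_Ln card_Union_bracket_pairs)
  moreover have "(face_basis n s :: 'f vpoly set) \<subseteq> vp.span (case_prod bracket ` ?I)"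
    using face_basis_subset_span_brackets[OF assms(1), of n s] img by simp
  ultimately show "inj_on (case_prod bracket :: _ \<Rightarrow> 'f vpoly) ?I"
    "\<not> vp.dependent (\<Union>j\<le>s. brackets n s j :: 'f vpoly set)"
    using vp.independent_family_if_spanning[of ?I "face_basis n s"] independent_face_basis
    unfolding img by blast+
qed

text \<open>For \<open>n \<le> 1\<close> the field may have characteristic 2; then the brackets of \<open>E\<^bsub>1,0\<^esub>\<close> and
  \<open>E\<^bsub>1,1\<^esub>\<close> coincide, but each of these spaces still has dimension 1.\<close>

lemma independent_brackets:
  assumes "(2::'f::field) \<noteq> 0 \<or> n \<le> 1" "j \<le> s" "s \<le> n"
  shows "inj_on (case_prod bracket :: _ \<Rightarrow> 'f vpoly) (bracket_pairs n s j)"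
    and "\<not> vp.dependent (brackets n s j :: 'f vpoly set)"
proof -
  have "inj_on (case_prod bracket :: _ \<Rightarrow> 'f vpoly) (bracket_pairs n s j) \<and>
    \<not> vp.dependent (brackets n s j :: 'f vpoly set)"
  proof (cases "(2::'f) \<noteq> 0")
    case True
    have "bracket_pairs n s j \<subseteq> (\<Union>j\<le>s. bracket_pairs n s j)"
      "brackets n s j \<subseteq> (\<Union>j\<le>s. brackets n s j :: 'f vpoly set)" using assms by auto
    then show ?thesis
      using independent_Union_brackets[OF True assms(3)] inj_on_subset vp.independent_mono by blast
  next
    case False
    then have n: "n \<le> 1" using assms by simp
    have "card (bracket_pairs n s j) = 1"
    proof -
      have "n = 0 \<or> n = 1" "s = 0 \<or> s = n" "j = 0 \<or> j = s" using n assms(2,3) by linarith+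
      then show ?thesis using assms(2,3) by (elim disjE) (simp_all add: card_bracket_pairs)
    qed
    then obtain p where "bracket_pairs n s j = {p}" by (rule card_1_singletonE)
    then obtain a b where ab: "bracket_pairs n s j = {(a, b)}" by (cases p) blast
    then have "(a, b) \<in> bracket_pairs n s j" by blast
    then have ab': "a \<subseteq> Vdot n" "b \<subseteq> Vdot n" "a \<inter> b = {}"
      unfolding bracket_pairs_def by blast+
    have cases: "a = {} \<and> b = {} \<or> (\<exists>v. a = {v} \<and> b = {}) \<or> (\<exists>v. a = {} \<and> b = {v})"
    proof -
      have "Vdot n \<subseteq> {(1, True)}" using n by (auto simp: Vdot_def)
      then have "a = {} \<or> a = {(1, True)}" "b = {} \<or> b = {(1, True)}"
        using ab' by blast+
      then show ?thesis using ab'(3) by blast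
    qed
    have ne: "v \<noteq> bar v" for v by (simp add: bar_def prod_eq_iff)
    \<comment> \<open>Since \<open>v \<noteq> bar v\<close>, the monomial of
      \<open>a \<union> b\<close> keeps coefficient 1 in any characteristic, so the only bracket is
      nonzero.\<close>
    have "Poly_Mapping.lookup (bracket a b :: 'f vpoly) (mset_set (a \<union> b)) = 1"
      using cases
    proof (elim disjE exE conjE)
      fix v assume "a = {v}" "b = {}"
      then show ?thesis
        using ne[of v] by (simp add: bracket_def var_def lookup_add lookup_single when_def)
    next
      fix v assume "a = {}" "b = {v}"
      then show ?thesis
        using ne[of v] by (simp add: bracket_def var_def lookup_minus lookup_single when_def)
    qed (simp add: bracket_def lookup_one)
    then have "(bracket a b :: 'f vpoly) \<noteq> 0" by auto
    then show ?thesis by (simp add: brackets_def ab)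
  qed
  then show "inj_on (case_prod bracket :: _ \<Rightarrow> 'f vpoly) (bracket_pairs n s j)"
    and "\<not> vp.dependent (brackets n s j :: 'f vpoly set)" by blast+
qed

lemma card_brackets:
  assumes "(2::'f::field) \<noteq> 0 \<or> n \<le> 1" "j \<le> s" "s \<le> n"
  shows "card (brackets n s j :: 'f vpoly set) = (n choose s) * (s choose j)"
  using assms by (simp add: brackets_def card_image independent_brackets card_bracket_pairs)

lemma finite_brackets: "finite (brackets n s j)"
  by (simp add: brackets_def finite_bracket_pairs)

section \<open>The rank of the inclusion maps\<close>

lemma eps_bracket_pairs:
  assumes "(a, b) \<in> bracket_pairs n t j" "j \<le> t" "t \<le> k"
  shows "(eps n t k (bracket a b) :: 'f::field vpoly) =
    (\<Sum>a' | a \<subseteq> a' \<and> a' \<subseteq> Vdot n - b \<and> card a' = k - j. bracket a' b)"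
  using assms by (subst eps_bracket) (auto simp: bracket_pairs_def)

lemma eps_image_En:
  "eps n t k ` (En n t j :: 'f::field vpoly set) = vp.span (eps n t k ` brackets n t j)"
proof -
  interpret eps: Vector_Spaces.linear vscale vscale "eps n t k :: 'f vpoly \<Rightarrow> 'f vpoly"
    by (rule linear_eps)
  show ?thesis by (simp add: En_eq eps.span_image)
qed

text \<open>The map changes only the first component of a bracket, so \<open>j = card b\<close> is
  preserved.\<close>

lemma eps_brackets_subset_En:
  assumes "j \<le> t" "t \<le> k"
  shows "eps n t k ` (brackets n t j :: 'f::field vpoly set) \<subseteq> En n k j"
proof
  fix x :: "'f vpoly" assume "x \<in> eps n t k ` brackets n t j"
  then obtain a b where ab: "(a, b) \<in> bracket_pairs n t j" "x = eps n t k (bracket a b)"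
    by (auto simp: brackets_def)
  have "bracket a' b \<in> En n k j" if "a' \<subseteq> Vdot n - b" "card a' = k - j" for a'
  proof -
    have "(a', b) \<in> bracket_pairs n k j" using ab that by (auto simp: bracket_pairs_def)
    then show ?thesis unfolding En_eq brackets_def by (force intro: vp.span_base)
  qed
  then show "x \<in> En n k j"
    unfolding ab(2) eps_bracket_pairs[OF ab(1) assms] En_eq by (auto intro!: vp.span_sum)
qed

lemma eps_En_subset:
  assumes "j \<le> t" "t \<le> k"
  shows "eps n t k ` (En n t j :: 'f::field vpoly set) \<subseteq> En n k j"
  unfolding eps_image_En using eps_brackets_subset_En[OF assms, of n]
  by (intro vp.span_minimal) (auto simp: En_eq)

text \<open>Independence of the target brackets separates the different \<open>b\<close>. For each
  \<open>b\<close> there remains the inclusion matrix on the \<open>n - j\<close> points of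
  \<open>Vdot n - b\<close> with \<open>r = t - j\<close> and \<open>s = k - j\<close>; then
  \<open>r + s \<le> n - j\<close> is \<open>t + k \<le> n + j\<close>.\<close>

lemma eps_injective_on_brackets:
  fixes f :: "vertex set \<times> vertex set \<Rightarrow> 'f::field"
  assumes char: "CHAR('f) = 0 \<or> CHAR('f) > n" and two: "(2::'f) \<noteq> 0 \<or> n \<le> 1"
    and le: "j \<le> t" "t \<le> k" "k \<le> n" "t + k \<le> n + j"
    and sum0: "(\<Sum>p\<in>bracket_pairs n t j. vscale (f p) (eps n t k (case_prod bracket p))) = 0"
    and p0: "(a0, b0) \<in> bracket_pairs n t j"
  shows "f (a0, b0) = 0"
proof -
  let ?Up = "\<lambda>p. {a'. fst p \<subseteq> a' \<and> a' \<subseteq> Vdot n - snd p \<and> card a' = k - j}"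
  let ?Down = "\<lambda>q. {a. a \<subseteq> fst q \<and> card a = t - j}"
  \<comment> \<open>The coefficient of \<open>case_prod bracket q\<close> in the image.\<close>
  define g where "g q = (\<Sum>a\<in>?Down q. f (a, snd q))" for q
  have finUp: "finite (?Up p)" for p
    by (rule finite_subset[of _ "Pow (Vdot n)"]) auto
  have finDown: "finite (?Down q)" if "q \<in> bracket_pairs n k j" for q
    using that finite_subset_Vdot[of "fst q" n]
    by (rule_tac finite_subset[of _ "Pow (fst q)"]) (auto simp: bracket_pairs_def)
  have "0 = (\<Sum>p\<in>bracket_pairs n t j. \<Sum>a'\<in>?Up p. vscale (f p) (bracket a' (snd p)))"
    unfolding sum0[symmetric]
  proof (rule sum.cong[OF refl])
    fix p assume "p \<in> bracket_pairs n t j"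
    then have "eps n t k (case_prod bracket p) = (\<Sum>a'\<in>?Up p. bracket a' (snd p) :: 'f vpoly)"
      using eps_bracket_pairs[OF _ le(1,2), of "fst p" "snd p" n, where 'f = 'f]
      by (simp add: case_prod_unfold)
    then show "vscale (f p) (eps n t k (case_prod bracket p)) =
      (\<Sum>a'\<in>?Up p. vscale (f p) (bracket a' (snd p)))"
      by (simp only: vp.scale_sum_right)
  qed
  also have "\<dots> = (\<Sum>(p, a')\<in>Sigma (bracket_pairs n t j) ?Up. vscale (f p) (bracket a' (snd p)))"
    using finUp by (intro sum.Sigma) (auto simp: finite_bracket_pairs)
  \<comment> \<open>Sorting by target instead of source: \<open>((a, b), a')\<close> is read as
    \<open>((a', b), a)\<close>.\<close>
  also have "\<dots> = (\<Sum>(q, a)\<in>Sigma (bracket_pairs n k j) ?Down.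
      vscale (f (a, snd q)) (case_prod bracket q))"
    by (rule sum.reindex_bij_witness[of _ "\<lambda>(q, a). ((a, snd q), fst q)" "\<lambda>(p, a'). ((a', snd p), fst p)"])
       (auto simp: bracket_pairs_def, blast+)
  also have "\<dots> = (\<Sum>q\<in>bracket_pairs n k j. \<Sum>a\<in>?Down q. vscale (f (a, snd q)) (case_prod bracket q))"
    using finDown by (intro sum.Sigma[symmetric]) (auto simp: finite_bracket_pairs)
  also have "\<dots> = (\<Sum>q\<in>bracket_pairs n k j. vscale (g q) (case_prod bracket q))"
    by (simp add: g_def vp.scale_sum_left)
  finally have sum_g: "(\<Sum>q\<in>bracket_pairs n k j. vscale (g q) (case_prod bracket q)) = 0" by (rule sym)
  have "j \<le> k" using le by simp
  note indep = independent_brackets[OF two this le(3), unfolded brackets_def]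
  have g0: "g q = 0" if "q \<in> bracket_pairs n k j" for q
    by (rule vp.independent_familyD[OF finite_bracket_pairs indep sum_g that])
  have b0: "b0 \<subseteq> Vdot n" "card b0 = j" "a0 \<subseteq> Vdot n - b0" "card a0 = t - j"
    using p0 by (auto simp: bracket_pairs_def)
  have card: "card (Vdot n - b0) = n - j"
    using b0 finite_subset_Vdot[of b0 n] by (simp add: card_Diff_subset)
  have "f (a, b0) = 0" if "a \<subseteq> Vdot n - b0" "card a = t - j" for a
  proof (rule inclusion_matrix_injective[where f = "\<lambda>a. f (a, b0)", OF _ _ char _ _ _ that])
    fix y assume "y \<subseteq> Vdot n - b0" "card y = k - j"
    then have "(y, b0) \<in> bracket_pairs n k j" using b0 by (auto simp: bracket_pairs_def)
    then show "(\<Sum>x | x \<subseteq> y \<and> card x = t - j. f (x, b0)) = 0" using g0[of "(y, b0)"] by (simp add: g_def)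
  qed (use card le in auto)
  then show ?thesis using b0 by blast
qed

text \<open>For fixed \<open>b\<close>, the row sums in \<open>inclusion_matrix_surjective\<close>
  are the images of the brackets \<open>bracket a b\<close>, and its size condition on
  \<open>Vdot n - b\<close> becomes \<open>n + j \<le> t + k\<close>.\<close>

lemma eps_surjective_on_brackets:
  assumes char: "CHAR('f::field) = 0 \<or> CHAR('f) > n"
    and le: "j \<le> t" "t \<le> k" "k \<le> n" "n + j \<le> t + k"
  shows "brackets n k j \<subseteq> (vp.span (eps n t k ` brackets n t j) :: 'f vpoly set)"
proof
  fix x :: "'f vpoly" assume "x \<in> brackets n k j"
  then obtain A b where "(A, b) \<in> bracket_pairs n k j" "x = bracket A b"
    by (auto simp: brackets_def)
  then have x: "x = bracket A b" "A \<subseteq> Vdot n - b" "b \<subseteq> Vdot n" "card A = k - j" "card b = j"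
    by (auto simp: bracket_pairs_def)
  have card: "card (Vdot n - b) = n - j"
    using x finite_subset_Vdot[of b n] by (simp add: card_Diff_subset)
  show "x \<in> vp.span (eps n t k ` brackets n t j)"
    unfolding x(1)
  proof (rule vp.inclusion_matrix_surjective[where e = "\<lambda>a. bracket a b" and X = "Vdot n - b"
        and m = n and r = "t - j" and s = "k - j"])
    fix a assume a: "a \<subseteq> Vdot n - b" "card a = t - j"
    then have ab: "(a, b) \<in> bracket_pairs n t j" using x by (auto simp: bracket_pairs_def)
    have "eps n t k (bracket a b) \<in> (vp.span (eps n t k ` brackets n t j) :: 'f vpoly set)"
      using ab by (intro vp.span_base) (force simp: brackets_def)
    then show "(\<Sum>y | a \<subseteq> y \<and> y \<subseteq> Vdot n - b \<and> card y = k - j. bracket y b) \<in>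
        (vp.span (eps n t k ` brackets n t j) :: 'f vpoly set)"
      using eps_bracket_pairs[OF ab le(1,2), where 'f = 'f] by simp
  qed (use x card char le in auto)
qed

text \<open>No binomials are compared directly: which term of \<open>min\<close> is smaller follows
  from Steinitz, as the image family is independent inside the target in one regime and spans it in
  the other.\<close>

lemma dim_eps_En:
  assumes char: "CHAR('f::field) = 0 \<or> CHAR('f) > n" and two: "(2::'f) \<noteq> 0 \<or> n \<le> 1"
    and le: "j \<le> t" "t \<le> k" "k \<le> n"
  shows "vp.dim (eps n t k ` (En n t j :: 'f vpoly set)) =
    min ((n choose t) * (t choose j)) ((n choose k) * (k choose j))"
proof -
  let ?B = "brackets n t j :: 'f vpoly set" and ?B' = "brackets n k j :: 'f vpoly set"
  have cards: "card ?B = (n choose t) * (t choose j)" "card ?B' = (n choose k) * (k choose j)"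
    using le by (auto intro!: card_brackets[OF two])
  have sub: "eps n t k ` ?B \<subseteq> vp.span ?B'"
    using eps_brackets_subset_En[OF le(1,2)] by (simp add: En_eq)
  show ?thesis
  proof (cases "t + k \<le> n + j")
    case True
    let ?g = "\<lambda>p. eps n t k (case_prod bracket p) :: 'f vpoly"
    have img: "?g ` bracket_pairs n t j = eps n t k ` ?B"
      by (simp add: brackets_def image_image)
    have eq0: "f p = 0" if "(\<Sum>p\<in>bracket_pairs n t j. vscale (f p) (?g p)) = 0"
      "p \<in> bracket_pairs n t j" for f p
      using eps_injective_on_brackets[OF char two le True that(1)] that(2) by (cases p) blast
    have indep: "inj_on ?g (bracket_pairs n t j)" "\<not> vp.dependent (eps n t k ` ?B)"
      unfolding img[symmetric]
      by (rule vp.independent_familyI[OF finite_bracket_pairs], erule (1) eq0)+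
    have card: "card (eps n t k ` ?B) = (n choose t) * (t choose j)"
      using card_image[OF indep(1)] img card_bracket_pairs[of j t n] le by simp
    have "card (eps n t k ` ?B) \<le> card ?B'"
      by (rule vp.card_le_of_independent_in_span[OF finite_brackets indep(2) sub])
    then show ?thesis
      using card cards vp.dim_span_eq_card_independent[OF indep(2)] by (simp add: eps_image_En)
  next
    case False
    then have sup: "?B' \<subseteq> vp.span (eps n t k ` ?B)"
      using eps_surjective_on_brackets[OF char le] by simp
    have indep: "\<not> vp.dependent ?B'" using le by (intro independent_brackets[OF two]) auto
    have "card ?B' \<le> card (eps n t k ` ?B)"
      by (rule vp.card_le_of_independent_in_span[OF _ indep sup]) (simp add: finite_brackets)
    also have "\<dots> \<le> card ?B" by (simp add: card_image_le finite_brackets)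
    finally have "card ?B' \<le> card ?B" .
    moreover have "vp.span (eps n t k ` ?B) = vp.span ?B'"
      using sub sup by (simp add: vp.span_eq)
    ultimately show ?thesis
      using cards vp.dim_span_eq_card_independent[OF indep] by (simp add: eps_image_En)
  qed
qed

section \<open>Rank and matrix on the whole face space\<close>

text \<open>The image of each \<open>En n t j\<close> lies in \<open>En n k j\<close>, and the
  latter form a direct sum because the brackets of size \<open>k\<close> are independent. Hence the
  ranks add up.\<close>

lemma dim_eps_Mn_eq_sum:
  assumes two: "(2::'f::field) \<noteq> 0" and le: "t \<le> k" "k \<le> n"
  shows "vp.dim (eps n t k ` (Mn n t :: 'f vpoly set)) =
    (\<Sum>j\<le>t. vp.dim (eps n t k ` (En n t j :: 'f vpoly set)))"
proof -
  interpret eps: Vector_Spaces.linear vscale vscale "eps n t k :: 'f vpoly \<Rightarrow> 'f vpoly"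
    by (rule linear_eps)
  let ?V = "\<lambda>j. eps n t k ` (brackets n t j :: 'f vpoly set)"
  \<comment> \<open>The images of the brackets may be dependent, so a basis \<open>C j\<close> of
    their span is extracted for each \<open>j\<close>.\<close>
  have "\<exists>C. C \<subseteq> ?V j \<and> \<not> vp.dependent C \<and> ?V j \<subseteq> vp.span C" for j
    using vp.maximal_independent_subset[of "?V j"] by metis
  then obtain C where C: "\<And>j. C j \<subseteq> ?V j" "\<And>j. \<not> vp.dependent (C j)" "\<And>j. ?V j \<subseteq> vp.span (C j)"
    by metis
  have spanC: "vp.span (C j) = vp.span (?V j)" for j
    using C(1,3)[of j] vp.span_mono[OF C(1)[of j]] by (intro vp.span_eq[THEN iffD2]) (auto intro: vp.span_base)
  have sub: "(\<Union>j\<le>t. brackets n k j) \<subseteq> (\<Union>j\<le>k. brackets n k j :: 'f vpoly set)"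
    using le by (auto intro: order_trans)
  \<comment> \<open>Equal brackets come from equal pairs, and pairs for different \<open>j\<close>
    differ in \<open>card b\<close>.\<close>
  have disj: "disjoint_family_on (brackets n k :: nat \<Rightarrow> 'f vpoly set) {..t}"
    unfolding disjoint_family_on_def
  proof (intro ballI impI)
    fix i j assume ij: "i \<in> {..t}" "j \<in> {..t}" "i \<noteq> j"
    have "brackets n k i \<inter> (brackets n k j :: 'f vpoly set) =
        case_prod bracket ` (bracket_pairs n k i \<inter> bracket_pairs n k j)"
      unfolding brackets_def
    proof (rule inj_on_image_Int[OF independent_Union_brackets(1)[OF two le(2)], symmetric])
      have "i \<le> k" "j \<le> k" using ij le by auto
      then show "bracket_pairs n k i \<subseteq> (\<Union>j\<le>k. bracket_pairs n k j)"
        "bracket_pairs n k j \<subseteq> (\<Union>j\<le>k. bracket_pairs n k j)" by blast+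
    qed
    also have "bracket_pairs n k i \<inter> bracket_pairs n k j = {}"
      using ij by (auto simp: bracket_pairs_def)
    finally show "brackets n k i \<inter> (brackets n k j :: 'f vpoly set) = {}" by simp
  qed
  have CE: "C j \<subseteq> vp.span (brackets n k j)" if "j \<le> t" for j
    using C(1)[of j] eps_brackets_subset_En[OF that le(1), of n, where 'f = 'f] by (auto simp: En_eq)
  have finC: "finite (C j)" for j
    by (rule finite_subset[OF C(1)]) (simp add: finite_brackets)
  note indep = vp.independent_Union_of_components[of "{..t}" "brackets n k" C,
      OF _ vp.independent_mono[OF independent_Union_brackets(2)[OF two le(2)] sub] disj finC C(2) CE]
  have "eps n t k ` (Mn n t :: 'f vpoly set) = vp.span (\<Union>j\<le>t. ?V j)"
    by (simp add: Mn_eq_span_brackets[OF two] eps.span_image[symmetric] image_UN)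
  also have "\<dots> = vp.span (\<Union>j\<le>t. C j)"
  proof (rule vp.span_eq[THEN iffD2], intro conjI UN_least)
    fix j assume j: "j \<in> {..t}"
    show "?V j \<subseteq> vp.span (\<Union>j\<le>t. C j)"
      using C(3)[of j] vp.span_mono[of "C j" "\<Union>j\<le>t. C j"] j by blast
    show "C j \<subseteq> vp.span (\<Union>j\<le>t. ?V j)"
      using C(1)[of j] j by (auto intro!: vp.span_base)
  qed
  finally have "vp.dim (eps n t k ` (Mn n t :: 'f vpoly set)) = card (\<Union>j\<le>t. C j)"
    using vp.dim_span_eq_card_independent[OF indep(1)] by simp
  also have "\<dots> = (\<Sum>j\<le>t. card (C j))" using indep(2) by simp
  also have "\<dots> = (\<Sum>j\<le>t. vp.dim (eps n t k ` (En n t j :: 'f vpoly set)))"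
    using vp.dim_span_eq_card_independent[OF C(2)] by (simp add: eps_image_En spanC)
  finally show ?thesis .
qed

text \<open>No \<open>t\<close>-face contains another one, so the map fixes every face. The
  dimension is written as a sum to match the rank formula for \<open>t = k\<close>.\<close>

lemma dim_eps_Mn_self:
  assumes "t \<le> n"
  shows "vp.dim (eps n t t ` (Mn n t :: 'f::field vpoly set)) = (\<Sum>j\<le>t. (n choose t) * (t choose j))"
proof -
  interpret eps: Vector_Spaces.linear vscale vscale "eps n t t :: 'f vpoly \<Rightarrow> 'f vpoly"
    by (rule linear_eps)
  have "eps n t t (face x) = (face x :: 'f vpoly)" if x: "x \<in> Ln n t" for x
  proof -
    have "x = y" if "y \<in> Ln n t" "x \<subseteq> y" for y
      using card_subset_eq[OF finite_face[OF that(1)] that(2)] x that(1) by (simp add: Ln_def)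
    then have "{y. y \<in> Ln n t \<and> x \<subseteq> y} = {x}" using x by auto
    then show ?thesis using eps_face[OF x, of t] by simp
  qed
  then have "eps n t t ` face_basis n t = (face_basis n t :: 'f vpoly set)"
    by (simp add: face_basis_def image_image)
  then have "vp.dim (eps n t t ` (Mn n t :: 'f vpoly set)) = card (face_basis n t :: 'f vpoly set)"
    using vp.dim_span_eq_card_independent[OF independent_face_basis]
    by (simp add: Mn_def eps.span_image[symmetric])
  also have "\<dots> = (n choose t) * (\<Sum>j\<le>t. t choose j)"
    by (simp add: face_basis_def card_image[OF inj_on_face] card_Ln choose_row_sum)
  finally show ?thesis by (simp add: sum_distrib_left)
qed

lemma Mn_0: "(Mn n 0 :: 'f::field vpoly set) = En n 0 0"
proof -
  have "x = {}" if "x \<in> Ln n 0" for x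
    using finite_face[OF that] that by (simp add: Ln_def)
  moreover have "{} \<in> Ln n 0" by (simp add: Ln_def)
  ultimately have "Ln n 0 = {{}}" by blast
  moreover have "bracket_pairs n 0 0 = {({}, {})}"
    using finite_subset_Vdot[of _ n] by (auto simp: bracket_pairs_def)
  ultimately show ?thesis
    by (simp add: Mn_def En_eq face_basis_def brackets_def face_def bracket_def)
qed

text \<open>In characteristic 2 the spaces \<open>E\<^bsub>t,j\<^esub>\<close> are not independent, but then \<open>n \<le> 1\<close>, which
  leaves only \<open>t = k\<close> and \<open>t = 0\<close>.\<close>

lemma dim_eps_Mn:
  assumes char: "CHAR('f::field) = 0 \<or> CHAR('f) > n" and two: "(2::'f) \<noteq> 0 \<or> n \<le> 1"
    and le: "t \<le> k" "k \<le> n"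
  shows "vp.dim (eps n t k ` (Mn n t :: 'f vpoly set)) =
    (\<Sum>j\<le>t. min ((n choose t) * (t choose j)) ((n choose k) * (k choose j)))"
proof -
  consider "(2::'f) \<noteq> 0" | "t = k" | "t = 0" using two le by linarith
  then show ?thesis
  proof cases
    case 1
    then show ?thesis
      using dim_eps_Mn_eq_sum[OF 1 le] dim_eps_En[OF char two _ le] by simp
  next
    case 2
    then show ?thesis using dim_eps_Mn_self[of k n] le by simp
  next
    case 3
    then show ?thesis using dim_eps_En[OF char two _ le, of 0] by (simp add: Mn_0)
  qed
qed

lemma eps_Mn_subset: "eps n t k ` (Mn n t :: 'f::field vpoly set) \<subseteq> Mn n k"
proof -
  interpret eps: Vector_Spaces.linear vscale vscale "eps n t k :: 'f vpoly \<Rightarrow> 'f vpoly"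
    by (rule linear_eps)
  have "eps n t k ` face_basis n t \<subseteq> (vp.span (face_basis n k) :: 'f vpoly set)"
  proof
    fix p :: "'f vpoly" assume "p \<in> eps n t k ` face_basis n t"
    then obtain x where x: "x \<in> Ln n t" "p = eps n t k (face x)"
      by (auto simp: face_basis_def)
    show "p \<in> vp.span (face_basis n k)"
      unfolding x(2) eps_face[OF x(1)]
      by (rule vp.span_sum, rule vp.span_base) (simp add: face_basis_def)
  qed
  then show ?thesis
    unfolding Mn_def eps.span_image[symmetric] by (intro vp.span_minimal) auto
qed

text \<open>Coordinates in the face basis are matrix entries, so this identifies the matrix of the
  map with the incidence matrix of faces.\<close>

lemma representation_eps_face:
  assumes "x \<in> Ln n t" "y \<in> Ln n k"
  shows "vp.representation (face_basis n k) (eps n t k (face x :: 'f::field vpoly)) (face y) = incidence x y"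
proof -
  let ?B = "face_basis n k :: 'f vpoly set" and ?Y = "{z. z \<in> Ln n k \<and> x \<subseteq> z}"
  have B: "(face z :: 'f vpoly) \<in> ?B" if "z \<in> ?Y" for z using that by (auto simp: face_basis_def)
  have "vp.representation ?B (eps n t k (face x)) (face y) =
      (\<Sum>z\<in>?Y. vp.representation ?B (face z) (face y))"
    unfolding eps_face[OF assms(1)]
    using B by (subst vp.representation_sum[OF independent_face_basis]) (auto intro: vp.span_base)
  also have "\<dots> = (\<Sum>z\<in>?Y. if z = y then 1 else 0)"
  proof (rule sum.cong[OF refl])
    fix z assume z: "z \<in> ?Y"
    have "(face z = (face y :: 'f vpoly)) = (z = y)"
      using z assms inj_on_eq_iff[OF inj_on_face, of z n k y] by auto
    then show "vp.representation ?B (face z) (face y) = (if z = y then 1 else 0)"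
      using vp.representation_basis[OF independent_face_basis B[OF z]] by auto
  qed
  also have "\<dots> = incidence x y"
    using assms finite_Ln[of n k] by (simp add: incidence_def)
  finally show ?thesis .
qed

theorem theorem3p1:
  fixes n t k :: nat
  assumes "t \<le> k" and "k \<le> n"
    and "CHAR('f::field) = 0 \<or> CHAR('f) > n"
  shows "(\<forall>j\<le>t.
            eps n t k ` (En n t j :: 'f vpoly set) \<subseteq> En n k j \<and>
            vp.dim (eps n t k ` (En n t j :: 'f vpoly set)) =
              min ((n choose t) * (t choose j)) ((n choose k) * (k choose j))) \<and>
         eps n t k ` (Mn n t :: 'f vpoly set) \<subseteq> Mn n k \<and>
         (\<forall>x\<in>Ln n t. \<forall>y\<in>Ln n k.
            vp.representation (face_basis n k) (eps n t k (face x :: 'f vpoly)) (face y) =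
              incidence x y) \<and>
         vp.dim (eps n t k ` (Mn n t :: 'f vpoly set)) =
           (\<Sum>j\<le>t. min ((n choose t) * (t choose j)) ((n choose k) * (k choose j)))"
proof -
  \<comment> \<open>As \<open>2 = 2 choose 1\<close>, it is nonzero in the field once
    \<open>n \<ge> 2\<close>; characteristic 2 can occur only for \<open>n \<le> 1\<close>.\<close>
  have two: "(2::'f) \<noteq> 0 \<or> n \<le> 1"
    using of_nat_choose_neq_0[OF assms(3), of 2 1] by (cases "n \<le> 1") auto
  show ?thesis
  proof (intro conjI allI ballI impI)
    fix j assume j: "j \<le> t"
    show "eps n t k ` (En n t j :: 'f vpoly set) \<subseteq> En n k j"
      by (rule eps_En_subset[OF j assms(1)])
    show "vp.dim (eps n t k ` (En n t j :: 'f vpoly set)) =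
        min ((n choose t) * (t choose j)) ((n choose k) * (k choose j))"
      by (rule dim_eps_En[OF assms(3) two j assms(1,2)])
  qed (rule eps_Mn_subset representation_eps_face dim_eps_Mn[OF assms(3) two assms(1,2)]; assumption)+
qed

end
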